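(* Let $\Gamma$ be a finite simplicial graph without central vertices and let $\mathcal{G} = \{G_v \mid v \in V\Gamma\}$ be a family of non-trivial finitely generated residually finite groups. Then the graph product $\Gamma\mathcal{G}$ is inner automorphism separable (IAS) and, consequently, $\operatorname{Out}(\Gamma\mathcal{G})$ is residually finite.
   Context: Graphs are simplicial: $V\Gamma$ is a set and $E\Gamma \subseteq \binom{V\Gamma}{2}$. The graph product $\Gamma\mathcal{G}$ of a family of groups $\mathcal{G} = \{G_v \mid v\in V\Gamma\}$ is the quotient of the free product $\ast_{v \in V\Gamma} G_v$ by the relations $g_u g_v = g_v g_u$ for all $g_u \in G_u$, $g_v \in G_v$ whenever $\{u,v\}\in E\Gamma$. A vertex $v \in V\Gamma$ is central in $\Gamma$ if $\{u,v\}\in E\Gamma$ for all $u \in V\Gamma\setminus\{v\}$. A group $G$ is inner automorphism separable (IAS) if for every $\phi \in \operatorname{Aut}(G)\setminus\operatorname{Inn}(G)$ there is a finite-index characteristic subgroup $K$ of $G$ such that $\tilde{\kappa}(\phi)\notin \operatorname{Inn}(G/K)$, where $\tilde{\kappa}\colon\operatorname{Aut}(G)\to\operatorname{Aut}(G/K)$ is given by $\tilde{\kappa}(\psi)(gK) = \psi(g)K$. Here $\operatorname{Out}(G) = \operatorname{Aut}(G)/\operatorname{Inn}(G)$. *)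

theory Defs
  imports "HOL-Algebra.Algebra"
begin

section \<open>Simplicial graphs\<close>

definition simplicial_graph :: "'v set \<Rightarrow> 'v set set \<Rightarrow> bool" where
  "simplicial_graph V E \<longleftrightarrow> E \<subseteq> {e. e \<subseteq> V \<and> card e = 2}"

definition central_vertex :: "'v set \<Rightarrow> 'v set set \<Rightarrow> 'v \<Rightarrow> bool" where
  "central_vertex V E v \<longleftrightarrow> v \<in> V \<and> (\<forall>u \<in> V - {v}. {u, v} \<in> E)"


section \<open>Free products\<close>

definition free_product_words :: "'i set \<Rightarrow> ('i \<Rightarrow> ('a, 'm) monoid_scheme) \<Rightarrow> ('i \<times> 'a) list set" where
  "free_product_words I G = lists (Sigma I (\<lambda>i. carrier (G i)))"

text \<open>
  The equivalence relation on words generated by deleting identity letters and by multiplying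
  adjacent letters that belong to the same factor.
\<close>

inductive_set free_product_rel ::
    "'i set \<Rightarrow> ('i \<Rightarrow> ('a, 'm) monoid_scheme) \<Rightarrow> (('i \<times> 'a) list \<times> ('i \<times> 'a) list) set"
  for I :: "'i set" and G :: "'i \<Rightarrow> ('a, 'm) monoid_scheme" where
  refl: "w \<in> free_product_words I G \<Longrightarrow> (w, w) \<in> free_product_rel I G"
| sym: "(w, w') \<in> free_product_rel I G \<Longrightarrow> (w', w) \<in> free_product_rel I G"
| trans: "(w, w') \<in> free_product_rel I G \<Longrightarrow> (w', w'') \<in> free_product_rel I G
    \<Longrightarrow> (w, w'') \<in> free_product_rel I G"
| delete: "x \<in> free_product_words I G \<Longrightarrow> y \<in> free_product_words I G \<Longrightarrow> i \<in> I
    \<Longrightarrow> (x @ [(i, \<one>\<^bsub>G i\<^esub>)] @ y, x @ y) \<in> free_product_rel I G"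
| merge: "x \<in> free_product_words I G \<Longrightarrow> y \<in> free_product_words I G \<Longrightarrow> i \<in> I
    \<Longrightarrow> g \<in> carrier (G i) \<Longrightarrow> h \<in> carrier (G i)
    \<Longrightarrow> (x @ [(i, g), (i, h)] @ y, x @ [(i, g \<otimes>\<^bsub>G i\<^esub> h)] @ y) \<in> free_product_rel I G"

definition free_product ::
    "'i set \<Rightarrow> ('i \<Rightarrow> ('a, 'm) monoid_scheme) \<Rightarrow> ('i \<times> 'a) list set monoid" where
  "free_product I G =
     \<lparr>carrier = free_product_words I G // free_product_rel I G,
      monoid.mult = \<lambda>A B. \<Union>a\<in>A. \<Union>b\<in>B. free_product_rel I G `` {a @ b},
      one = free_product_rel I G `` {[]}\<rparr>"

definition free_product_incl ::
    "'i set \<Rightarrow> ('i \<Rightarrow> ('a, 'm) monoid_scheme) \<Rightarrow> 'i \<Rightarrow> 'a \<Rightarrow> ('i \<times> 'a) list set" where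
  "free_product_incl I G i g = free_product_rel I G `` {[(i, g)]}"

context
  fixes I :: "'i set" and G :: "'i \<Rightarrow> ('a, 'm) monoid_scheme"
  assumes grp: "\<And>i. i \<in> I \<Longrightarrow> group (G i)"
begin

lemma free_product_words_append [simp]:
  "x @ y \<in> free_product_words I G \<longleftrightarrow> x \<in> free_product_words I G \<and> y \<in> free_product_words I G"
  by (auto simp: free_product_words_def)

lemma free_product_words_Nil [simp]: "[] \<in> free_product_words I G"
  by (simp add: free_product_words_def)

lemma free_product_words_Cons [simp]:
  "(i, g) # w \<in> free_product_words I G \<longleftrightarrow>
     i \<in> I \<and> g \<in> carrier (G i) \<and> w \<in> free_product_words I G"
  by (auto simp: free_product_words_def)

lemma free_product_rel_words:
  "(w, w') \<in> free_product_rel I G \<Longrightarrow> w \<in> free_product_words I G \<and> w' \<in> free_product_words I G"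
proof (induction rule: free_product_rel.induct)
  case (delete x y i)
  then interpret group "G i" using grp by simp
  show ?case using delete by simp
next
  case (merge x y i g h)
  then interpret group "G i" using grp by simp
  show ?case using merge by simp
qed auto

lemma equiv_free_product_rel: "equiv (free_product_words I G) (free_product_rel I G)"
proof (rule equivI)
  show "free_product_rel I G \<subseteq> free_product_words I G \<times> free_product_words I G"
    using free_product_rel_words by auto
  show "refl_on (free_product_words I G) (free_product_rel I G)"
    by (auto simp: refl_on_def intro: free_product_rel.refl)
  show "Relation.sym (free_product_rel I G)"
    by (auto intro: symI free_product_rel.sym)
  show "Relation.trans (free_product_rel I G)"
    by (auto intro: transI free_product_rel.trans)
qed

lemma free_product_rel_context:
  "(w, w') \<in> free_product_rel I G \<Longrightarrow> x \<in> free_product_words I G \<Longrightarrow> y \<in> free_product_words I G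
    \<Longrightarrow> (x @ w @ y, x @ w' @ y) \<in> free_product_rel I G"
proof (induction rule: free_product_rel.induct)
  case (refl w)
  then show ?case by (auto intro: free_product_rel.refl)
next
  case (sym w w')
  then show ?case by (auto intro: free_product_rel.sym)
next
  case (trans w w' w'')
  then show ?case by (blast intro: free_product_rel.trans)
next
  case (delete u v i)
  then show ?case using free_product_rel.delete[of "x @ u" I G "v @ y" i] by simp
next
  case (merge u v i g h)
  then show ?case using free_product_rel.merge[of "x @ u" I G "v @ y" i g h] by simp
qed

lemma free_product_rel_append:
  assumes "(a, a') \<in> free_product_rel I G" "(b, b') \<in> free_product_rel I G"
  shows "(a @ b, a' @ b') \<in> free_product_rel I G"
proof (rule free_product_rel.trans)
  show "(a @ b, a' @ b) \<in> free_product_rel I G"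
    using free_product_rel_context[OF assms(1), of "[]" b] free_product_rel_words[OF assms(2)] by simp
  show "(a' @ b, a' @ b') \<in> free_product_rel I G"
    using free_product_rel_context[OF assms(2), of a' "[]"] free_product_rel_words[OF assms(1)] by simp
qed

lemma free_product_mult:
  assumes "a \<in> free_product_words I G" "b \<in> free_product_words I G"
  shows "free_product_rel I G `` {a} \<otimes>\<^bsub>free_product I G\<^esub> free_product_rel I G `` {b}
       = free_product_rel I G `` {a @ b}"
proof -
  let ?R = "free_product_rel I G"
  have "?R `` {a' @ b'} = ?R `` {a @ b}" if "a' \<in> ?R `` {a}" "b' \<in> ?R `` {b}" for a' b'
    using equiv_class_eq[OF equiv_free_product_rel free_product_rel_append] that by blast
  moreover have "a \<in> ?R `` {a}" "b \<in> ?R `` {b}"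
    using assms by (auto intro: free_product_rel.refl)
  ultimately have "(\<Union>a'\<in>?R `` {a}. \<Union>b'\<in>?R `` {b}. ?R `` {a' @ b'}) = ?R `` {a @ b}"
    by blast
  then show ?thesis
    by (simp add: free_product_def)
qed

lemma free_product_carrier:
  "carrier (free_product I G) = {free_product_rel I G `` {w} |w. w \<in> free_product_words I G}"
  by (auto simp: free_product_def quotient_def)

lemma free_product_left_inverse:
  "w \<in> free_product_words I G \<Longrightarrow> \<exists>w' \<in> free_product_words I G. (w' @ w, []) \<in> free_product_rel I G"
proof (induction w)
  case Nil
  then show ?case by (intro bexI[of _ "[]"]) (auto intro: free_product_rel.refl)
next
  case (Cons p w)
  obtain i g where p: "p = (i, g)" by (cases p)
  with Cons obtain w' where w': "w' \<in> free_product_words I G" "(w' @ w, []) \<in> free_product_rel I G"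
    by auto
  from Cons p have i: "i \<in> I" "g \<in> carrier (G i)" and w: "w \<in> free_product_words I G" by auto
  interpret group "G i" using grp i by simp
  have merge: "(w' @ [(i, inv\<^bsub>G i\<^esub> g), (i, g)] @ w, w' @ [(i, \<one>\<^bsub>G i\<^esub>)] @ w) \<in> free_product_rel I G"
    using free_product_rel.merge[of w' I G w i "inv\<^bsub>G i\<^esub> g" g] i w w' by simp
  have delete: "(w' @ [(i, \<one>\<^bsub>G i\<^esub>)] @ w, w' @ w) \<in> free_product_rel I G"
    using free_product_rel.delete[of w' I G w i] i w w' by simp
  have "((w' @ [(i, inv\<^bsub>G i\<^esub> g)]) @ p # w, []) \<in> free_product_rel I G"
    using free_product_rel.trans[OF merge free_product_rel.trans[OF delete w'(2)]] p by simp
  moreover have "w' @ [(i, inv\<^bsub>G i\<^esub> g)] \<in> free_product_words I G"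
    using w' i by simp
  ultimately show ?case by blast
qed

lemma group_free_product: "group (free_product I G)"
proof (rule groupI)
  have one: "\<one>\<^bsub>free_product I G\<^esub> = free_product_rel I G `` {[]}"
    by (simp add: free_product_def)
  show "\<one>\<^bsub>free_product I G\<^esub> \<in> carrier (free_product I G)"
    unfolding one free_product_carrier by force
  show "x \<otimes>\<^bsub>free_product I G\<^esub> y \<in> carrier (free_product I G)"
    if "x \<in> carrier (free_product I G)" "y \<in> carrier (free_product I G)" for x y
    using that unfolding free_product_carrier by (force simp: free_product_mult)
  show "x \<otimes>\<^bsub>free_product I G\<^esub> y \<otimes>\<^bsub>free_product I G\<^esub> z
      = x \<otimes>\<^bsub>free_product I G\<^esub> (y \<otimes>\<^bsub>free_product I G\<^esub> z)"
    if "x \<in> carrier (free_product I G)" "y \<in> carrier (free_product I G)"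
      "z \<in> carrier (free_product I G)" for x y z
    using that unfolding free_product_carrier by (force simp: free_product_mult)
  show "\<one>\<^bsub>free_product I G\<^esub> \<otimes>\<^bsub>free_product I G\<^esub> x = x"
    if "x \<in> carrier (free_product I G)" for x
    using that unfolding free_product_carrier one by (force simp: free_product_mult)
  show "\<exists>y\<in>carrier (free_product I G). y \<otimes>\<^bsub>free_product I G\<^esub> x = \<one>\<^bsub>free_product I G\<^esub>"
    if x: "x \<in> carrier (free_product I G)" for x
  proof -
    obtain w where w: "w \<in> free_product_words I G" "x = free_product_rel I G `` {w}"
      using x unfolding free_product_carrier by auto
    obtain w' where w': "w' \<in> free_product_words I G" "(w' @ w, []) \<in> free_product_rel I G"
      using free_product_left_inverse[OF w(1)] by auto
    have "free_product_rel I G `` {w'} \<otimes>\<^bsub>free_product I G\<^esub> x = \<one>\<^bsub>free_product I G\<^esub>"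
      using w w' by (simp add: free_product_mult one equiv_class_eq[OF equiv_free_product_rel w'(2)])
    then show ?thesis using w' unfolding free_product_carrier by blast
  qed
qed

lemma free_product_incl_hom:
  assumes "i \<in> I"
  shows "free_product_incl I G i \<in> hom (G i) (free_product I G)"
proof (rule homI)
  show "free_product_incl I G i g \<in> carrier (free_product I G)" if "g \<in> carrier (G i)" for g
    using that assms unfolding free_product_incl_def free_product_carrier by auto
  show "free_product_incl I G i (g \<otimes>\<^bsub>G i\<^esub> h)
      = free_product_incl I G i g \<otimes>\<^bsub>free_product I G\<^esub> free_product_incl I G i h"
    if "g \<in> carrier (G i)" "h \<in> carrier (G i)" for g h
  proof -
    have "([(i, g), (i, h)], [(i, g \<otimes>\<^bsub>G i\<^esub> h)]) \<in> free_product_rel I G"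
      using free_product_rel.merge[of "[]" I G "[]" i g h] assms that by simp
    from equiv_class_eq[OF equiv_free_product_rel this]
    show ?thesis using assms that by (simp add: free_product_incl_def free_product_mult)
  qed
qed

end


section \<open>Graph products\<close>

definition normal_closure :: "('a, 'm) monoid_scheme \<Rightarrow> 'a set \<Rightarrow> 'a set" where
  "normal_closure G S = \<Inter>{N. N \<lhd> G \<and> S \<subseteq> N}"

lemma (in group) normal_normal_closure:
  assumes "S \<subseteq> carrier G"
  shows "normal_closure G S \<lhd> G"
proof -
  have "carrier G \<lhd> G"
    by (rule normal_invI) (auto intro: subgroup_self)
  then have ne: "{N. N \<lhd> G \<and> S \<subseteq> N} \<noteq> {}" using assms by auto
  have "subgroup (normal_closure G S) G"
    unfolding normal_closure_def
    by (rule subgroups_Inter) (use ne in \<open>auto intro: normal_imp_subgroup\<close>)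
  then show ?thesis
    by (rule normal_invI) (auto simp: normal_closure_def intro: normal.inv_op_closed2)
qed

definition graph_product_relators ::
    "'v set \<Rightarrow> 'v set set \<Rightarrow> ('v \<Rightarrow> ('a, 'm) monoid_scheme) \<Rightarrow> ('v \<times> 'a) list set set" where
  "graph_product_relators V E G =
     {(free_product_incl V G u g \<otimes>\<^bsub>free_product V G\<^esub> free_product_incl V G v h) \<otimes>\<^bsub>free_product V G\<^esub>
      inv\<^bsub>free_product V G\<^esub>
        (free_product_incl V G v h \<otimes>\<^bsub>free_product V G\<^esub> free_product_incl V G u g)
      | u v g h. {u, v} \<in> E \<and> g \<in> carrier (G u) \<and> h \<in> carrier (G v)}"

definition graph_product ::
    "'v set \<Rightarrow> 'v set set \<Rightarrow> ('v \<Rightarrow> ('a, 'm) monoid_scheme) \<Rightarrow> ('v \<times> 'a) list set set monoid" where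
  "graph_product V E G =
     free_product V G Mod normal_closure (free_product V G) (graph_product_relators V E G)"

lemma group_graph_product:
  assumes "simplicial_graph V E" "\<And>v. v \<in> V \<Longrightarrow> group (G v)"
  shows "group (graph_product V E G)"
proof -
  interpret P: group "free_product V G" using assms(2) by (rule group_free_product)
  have "graph_product_relators V E G \<subseteq> carrier (free_product V G)"
  proof
    fix r assume "r \<in> graph_product_relators V E G"
    then obtain u v g h where r: "r = (free_product_incl V G u g \<otimes>\<^bsub>free_product V G\<^esub> free_product_incl V G v h)
        \<otimes>\<^bsub>free_product V G\<^esub> inv\<^bsub>free_product V G\<^esub>
        (free_product_incl V G v h \<otimes>\<^bsub>free_product V G\<^esub> free_product_incl V G u g)"
      and uv: "{u, v} \<in> E" "g \<in> carrier (G u)" "h \<in> carrier (G v)"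
      unfolding graph_product_relators_def by blast
    have "u \<in> V" "v \<in> V" using uv(1) assms(1) unfolding simplicial_graph_def by auto
    then have "free_product_incl V G u g \<in> carrier (free_product V G)"
      "free_product_incl V G v h \<in> carrier (free_product V G)"
      using free_product_incl_hom[of V G, OF assms(2)] uv by (blast intro: hom_in_carrier)+
    then show "r \<in> carrier (free_product V G)" unfolding r by simp
  qed
  then show ?thesis
    unfolding graph_product_def
    by (intro normal.factorgroup_is_group P.normal_normal_closure)
qed


section \<open>Outer automorphism groups\<close>

text \<open>
  As in \<^const>\<open>AutoGroup\<close>, automorphisms are functions that are \<^const>\<open>undefined\<close> outside the carrier.
\<close>

definition inner_auto :: "('a, 'm) monoid_scheme \<Rightarrow> ('a \<Rightarrow> 'a) set" where
  "inner_auto G = {\<lambda>x\<in>carrier G. a \<otimes>\<^bsub>G\<^esub> x \<otimes>\<^bsub>G\<^esub> inv\<^bsub>G\<^esub> a | a. a \<in> carrier G}"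

definition Out :: "('a, 'm) monoid_scheme \<Rightarrow> ('a \<Rightarrow> 'a) set monoid" where
  "Out G = AutoGroup G Mod inner_auto G"

lemma (in group) normal_inner_auto: "inner_auto G \<lhd> AutoGroup G"
proof -
  interpret A: group "AutoGroup G" by (rule AutoGroup)
  define c where "c a = (\<lambda>x\<in>carrier G. a \<otimes> x \<otimes> inv a)" for a
  have inner: "inner_auto G = c ` carrier G"
    by (auto simp: inner_auto_def c_def)
  have c_auto: "c a \<in> auto G" if a: "a \<in> carrier G" for a
  proof -
    have "c a \<in> Bij (carrier G)"
      using conjugation_is_bij[OF a] by (auto simp: Bij_def c_def)
    moreover have "c a \<in> hom G G"
    proof (rule homI)
      fix x y assume xy: "x \<in> carrier G" "y \<in> carrier G"
      have "a \<otimes> (x \<otimes> y) \<otimes> inv a = a \<otimes> x \<otimes> (inv a \<otimes> a) \<otimes> y \<otimes> inv a"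
        using a xy by (simp add: m_assoc)
      also have "\<dots> = (a \<otimes> x \<otimes> inv a) \<otimes> (a \<otimes> y \<otimes> inv a)"
        using a xy by (simp only: m_assoc m_closed inv_closed)
      finally show "c a (x \<otimes> y) = c a x \<otimes> c a y"
        using xy by (simp add: c_def)
    qed (use a in \<open>simp add: c_def\<close>)
    ultimately show ?thesis by (simp add: auto_def)
  qed
  have carr: "carrier (AutoGroup G) = auto G"
    by (simp add: AutoGroup_def)
  have mult: "\<phi> \<otimes>\<^bsub>AutoGroup G\<^esub> \<psi> = compose (carrier G) \<phi> \<psi>" if "\<phi> \<in> auto G" "\<psi> \<in> auto G" for \<phi> \<psi>
    using that by (simp add: AutoGroup_def BijGroup_def auto_def)
  have one: "\<one>\<^bsub>AutoGroup G\<^esub> = (\<lambda>x\<in>carrier G. x)"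
    by (simp add: AutoGroup_def BijGroup_def)
  have c_mult: "c a \<otimes>\<^bsub>AutoGroup G\<^esub> c b = c (a \<otimes> b)" if "a \<in> carrier G" "b \<in> carrier G" for a b
    unfolding mult[OF c_auto[OF that(1)] c_auto[OF that(2)]]
    using that by (auto simp: compose_def c_def fun_eq_iff inv_mult_group m_assoc)
  have c_one: "c \<one> = \<one>\<^bsub>AutoGroup G\<^esub>"
    by (auto simp: c_def one fun_eq_iff)
  have c_inv: "inv\<^bsub>AutoGroup G\<^esub> (c a) = c (inv a)" if "a \<in> carrier G" for a
    by (rule A.inv_equality) (use that in \<open>auto simp: c_mult c_one carr c_auto\<close>)
  have "subgroup (inner_auto G) (AutoGroup G)"
  proof (rule A.subgroupI)
    show "inner_auto G \<subseteq> carrier (AutoGroup G)" using c_auto by (auto simp: inner carr)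
    show "inner_auto G \<noteq> {}" by (auto simp: inner)
    show "inv\<^bsub>AutoGroup G\<^esub> x \<in> inner_auto G" if "x \<in> inner_auto G" for x
      using that by (auto simp: inner c_inv)
    show "x \<otimes>\<^bsub>AutoGroup G\<^esub> y \<in> inner_auto G" if "x \<in> inner_auto G" "y \<in> inner_auto G" for x y
      using that by (auto simp: inner c_mult)
  qed
  then show ?thesis
  proof (rule A.normal_invI)
    fix \<phi> \<psi> assume \<phi>: "\<phi> \<in> carrier (AutoGroup G)" and "\<psi> \<in> inner_auto G"
    then obtain a where a: "a \<in> carrier G" "\<psi> = c a" by (auto simp: inner)
    have h: "\<phi> \<in> hom G G" "\<phi> \<in> auto G" using \<phi> by (auto simp: carr auto_def)
    interpret group_hom G G \<phi> by unfold_locales (rule h)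
    have "\<phi> \<otimes>\<^bsub>AutoGroup G\<^esub> c a = c (\<phi> a) \<otimes>\<^bsub>AutoGroup G\<^esub> \<phi>"
      unfolding mult[OF h(2) c_auto[OF a(1)]] mult[OF c_auto[OF hom_closed[OF a(1)]] h(2)]
      using a by (auto simp: compose_def c_def fun_eq_iff)
    then have "\<phi> \<otimes>\<^bsub>AutoGroup G\<^esub> \<psi> \<otimes>\<^bsub>AutoGroup G\<^esub> inv\<^bsub>AutoGroup G\<^esub> \<phi> = c (\<phi> a)"
      using \<phi> c_auto[OF hom_closed[OF a(1)], folded carr] by (simp add: a(2) A.m_assoc)
    then show "\<phi> \<otimes>\<^bsub>AutoGroup G\<^esub> \<psi> \<otimes>\<^bsub>AutoGroup G\<^esub> inv\<^bsub>AutoGroup G\<^esub> \<phi> \<in> inner_auto G"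
      using a by (auto simp: inner)
  qed
qed

lemma (in group) group_Out: "group (Out G)"
  unfolding Out_def by (intro normal.factorgroup_is_group normal_inner_auto)


section \<open>Residual finiteness and inner automorphism separability\<close>

definition finite_index :: "('a, 'm) monoid_scheme \<Rightarrow> 'a set \<Rightarrow> bool" where
  "finite_index G H \<longleftrightarrow> finite (rcosets\<^bsub>G\<^esub> H)"

definition finitely_generated_group :: "('a, 'm) monoid_scheme \<Rightarrow> bool" where
  "finitely_generated_group G \<longleftrightarrow>
     (\<exists>S. finite S \<and> S \<subseteq> carrier G \<and> generate G S = carrier G)"

definition residually_finite :: "('a, 'm) monoid_scheme \<Rightarrow> bool" where
  "residually_finite G \<longleftrightarrow>
     (\<forall>g \<in> carrier G - {\<one>\<^bsub>G\<^esub>}. \<exists>N. N \<lhd> G \<and> finite_index G N \<and> g \<notin> N)"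

definition characteristic_subgroup :: "'a set \<Rightarrow> ('a, 'm) monoid_scheme \<Rightarrow> bool" where
  "characteristic_subgroup K G \<longleftrightarrow> subgroup K G \<and> (\<forall>\<phi> \<in> auto G. \<phi> ` K = K)"

text \<open>
  The image of the coset of \<open>g\<close> under \<open>\<phi>\<close> is the coset of \<open>\<phi> g\<close> when \<open>K\<close> is characteristic;
  see \<open>induced_auto_coset\<close> below.
\<close>

definition induced_auto :: "('a, 'm) monoid_scheme \<Rightarrow> 'a set \<Rightarrow> ('a \<Rightarrow> 'a) \<Rightarrow> ('a set \<Rightarrow> 'a set)" where
  "induced_auto G K \<phi> = (\<lambda>C\<in>carrier (G Mod K). \<phi> ` C)"

definition inner_automorphism_separable :: "('a, 'm) monoid_scheme \<Rightarrow> bool" where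
  "inner_automorphism_separable G \<longleftrightarrow>
     (\<forall>\<phi> \<in> auto G - inner_auto G. \<exists>K. characteristic_subgroup K G \<and> finite_index G K \<and>
        induced_auto G K \<phi> \<notin> inner_auto (G Mod K))"

context group
begin

lemma characteristic_subgroup_normal:
  assumes "characteristic_subgroup K G"
  shows "K \<lhd> G"
proof (rule normal_invI)
  show K: "subgroup K G" using assms by (simp add: characteristic_subgroup_def)
  fix a k assume a: "a \<in> carrier G" and k: "k \<in> K"
  have "(\<lambda>x\<in>carrier G. a \<otimes> x \<otimes> inv a) \<in> inner_auto G"
    using a by (auto simp: inner_auto_def)
  also have "inner_auto G \<subseteq> auto G"
    using subgroup.subset[OF normal_imp_subgroup[OF normal_inner_auto]]
    by (simp add: AutoGroup_def)
  finally have "(\<lambda>x\<in>carrier G. a \<otimes> x \<otimes> inv a) ` K = K"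
    using assms unfolding characteristic_subgroup_def by blast
  moreover have "k \<in> carrier G" using K k by (rule subgroup.mem_carrier)
  ultimately show "a \<otimes> k \<otimes> inv a \<in> K" using k by (metis (no_types, lifting) image_eqI restrict_apply')
qed

lemma induced_auto_coset:
  assumes "characteristic_subgroup K G" "\<phi> \<in> auto G" "g \<in> carrier G"
  shows "induced_auto G K \<phi> (l_coset G g K) = l_coset G (\<phi> g) K"
proof -
  interpret K: normal K G using assms(1) by (rule characteristic_subgroup_normal)
  have "l_coset G g K \<in> carrier (G Mod K)"
    using K.coset_eq assms(3) by (auto simp: FactGroup_def RCOSETS_def)
  then have "induced_auto G K \<phi> (l_coset G g K) = \<phi> ` l_coset G g K"
    by (simp add: induced_auto_def)
  also have "\<dots> = (\<Union>k\<in>K. {\<phi> g \<otimes> \<phi> k})"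
  proof -
    have "\<phi> (g \<otimes> k) = \<phi> g \<otimes> \<phi> k" if "k \<in> K" for k
      using assms(2,3) K.mem_carrier[OF that] by (simp add: auto_def hom_def)
    then show ?thesis by (simp add: l_coset_def image_UN)
  qed
  also have "\<dots> = l_coset G (\<phi> g) (\<phi> ` K)"
    by (auto simp: l_coset_def)
  also have "\<phi> ` K = K"
    using assms by (simp add: characteristic_subgroup_def)
  finally show ?thesis .
qed

lemma induced_auto_in_auto:
  assumes K: "characteristic_subgroup K G" and \<phi>: "\<phi> \<in> auto G"
  shows "induced_auto G K \<phi> \<in> auto (G Mod K)"
proof -
  interpret K: normal K G using K by (rule characteristic_subgroup_normal)
  have carr: "carrier (G Mod K) = (\<lambda>g. l_coset G g K) ` carrier G"
    using K.coset_eq by (auto simp: FactGroup_def RCOSETS_def)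
  have mult: "l_coset G g K \<otimes>\<^bsub>G Mod K\<^esub> l_coset G h K = l_coset G (g \<otimes> h) K"
    if "g \<in> carrier G" "h \<in> carrier G" for g h
    using K.rcos_sum[OF that] K.coset_eq that by (simp add: FactGroup_def)
  have hom: "\<phi> \<in> hom G G" and bij: "bij_betw \<phi> (carrier G) (carrier G)"
    using \<phi> by (auto simp: auto_def Bij_def)
  then have cl: "\<phi> g \<in> carrier G" if "g \<in> carrier G" for g
    using that by (simp add: hom_in_carrier)
  have "induced_auto G K \<phi> \<in> hom (G Mod K) (G Mod K)"
  proof (rule homI)
    show "induced_auto G K \<phi> C \<in> carrier (G Mod K)" if "C \<in> carrier (G Mod K)" for C
      using that cl by (auto simp: carr induced_auto_coset[OF K \<phi>])
    show "induced_auto G K \<phi> (C \<otimes>\<^bsub>G Mod K\<^esub> D) = induced_auto G K \<phi> C \<otimes>\<^bsub>G Mod K\<^esub> induced_auto G K \<phi> D"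
      if "C \<in> carrier (G Mod K)" "D \<in> carrier (G Mod K)" for C D
    proof -
      obtain g h where gh: "g \<in> carrier G" "h \<in> carrier G"
        and [simp]: "C = l_coset G g K" "D = l_coset G h K"
        using \<open>C \<in> _\<close> \<open>D \<in> _\<close> by (auto simp: carr)
      have "\<phi> (g \<otimes> h) = \<phi> g \<otimes> \<phi> h" using hom gh by (simp add: hom_def)
      then show ?thesis
        using gh cl[OF gh(1)] cl[OF gh(2)] by (simp add: mult induced_auto_coset[OF K \<phi>] del: mult_FactGroup)
    qed
  qed
  moreover have "bij_betw (induced_auto G K \<phi>) (carrier (G Mod K)) (carrier (G Mod K))"
    unfolding bij_betw_def
  proof
    have sub: "C \<subseteq> carrier G" if "C \<in> carrier (G Mod K)" for C
      using that l_coset_subset_G[OF K.subset] by (auto simp: carr)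
    show "inj_on (induced_auto G K \<phi>) (carrier (G Mod K))"
    proof (rule inj_onI)
      fix C D assume "C \<in> carrier (G Mod K)" "D \<in> carrier (G Mod K)"
        and "induced_auto G K \<phi> C = induced_auto G K \<phi> D"
      then show "C = D"
        using inj_on_image_eq_iff[OF bij_betw_imp_inj_on[OF bij] sub sub]
        by (simp add: induced_auto_def)
    qed
    have "induced_auto G K \<phi> ` carrier (G Mod K) = (\<lambda>g. l_coset G g K) ` (\<phi> ` carrier G)"
      unfolding carr image_image by (rule image_cong) (auto simp: induced_auto_coset[OF K \<phi>])
    then show "induced_auto G K \<phi> ` carrier (G Mod K) = carrier (G Mod K)"
      using bij_betw_imp_surj_on[OF bij] by (simp add: carr)
  qed
  ultimately show ?thesis
    by (auto simp: auto_def Bij_def induced_auto_def)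
qed

end

end

theory Submission
  imports Defs
begin

text \<open>
  Let \<open>\<phi>\<close> be an automorphism that is inner in every finite quotient.  Consider the cosets \<open>t \<langle>S\<rangle>\<close>
  of full subgroups such that, modulo every normal subgroup of finite index, \<open>\<phi>\<close> is conjugation by
  an element of \<open>t \<langle>S\<rangle>\<close>, and take one with \<open>S\<close> minimal.  If an element \<open>g\<close> of a finite quotient
  conjugates a nontrivial \<open>a \<in> G u\<close> to the image of \<open>b = \<phi> a\<close>, then some suffix \<open>c\<close> of a fixed word
  for \<open>b\<close> satisfies \<open>c g \<in> \<langle>star u\<rangle>\<close>, so that, by the pigeonhole principle and a retraction,
  \<open>S\<close> may be replaced by \<open>S \<inter> star u\<close>.  Hence \<open>S\<close> lies in the star of every vertex, and \<open>S\<close> is empty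
  as no vertex is central.  The element \<open>t\<close> then induces \<open>\<phi>\<close>, by residual finiteness.

  Both the suffix property and residual finiteness are seen in finite quotients that are
  obtained by letting \<open>G v\<close> act by translations of a finite quotient of \<open>G v\<close> over a
  \<open>star v\<close>-invariant subset \<open>D\<close> of a given finite quotient of the graph product; they are encoded by
  the cocycles below, so that no normal form theorem is needed.
\<close>

section \<open>Normal subgroups of finite index\<close>

definition fin_normal :: "('a, 'm) monoid_scheme \<Rightarrow> 'a set \<Rightarrow> bool" where
  "fin_normal G N \<longleftrightarrow> N \<lhd> G \<and> finite_index G N"

lemma residually_finite_alt:
  "residually_finite G \<longleftrightarrow> (\<forall>g \<in> carrier G - {\<one>\<^bsub>G\<^esub>}. \<exists>N. fin_normal G N \<and> g \<notin> N)"
  by (simp add: residually_finite_def fin_normal_def conj_assoc)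

lemma fin_normalD:
  assumes "fin_normal G N"
  shows "N \<lhd> G" "subgroup N G" "finite_index G N"
  using assms by (auto simp: fin_normal_def normal_imp_subgroup)

context group
begin

lemma r_coset_eq_iff:
  assumes "subgroup N G" "x \<in> carrier G" "y \<in> carrier G"
  shows "N #> x = N #> y \<longleftrightarrow> x \<otimes> inv y \<in> N"
proof
  assume "N #> x = N #> y"
  then have "x \<in> N #> y" using rcos_self[OF assms(2,1)] by simp
  then show "x \<otimes> inv y \<in> N"
    using subgroup.rcos_module_imp[OF assms(1) is_group assms(3)] by simp
next
  assume "x \<otimes> inv y \<in> N"
  then have "x \<in> N #> y"
    using subgroup.rcos_module_rev[OF assms(1) is_group assms(3,2)] by simp
  then show "N #> x = N #> y"
    using repr_independence[OF _ assms(3,1)] by simp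
qed

text \<open>A coset of \<open>N\<close> is determined by the value of \<open>d\<close> on any
  representative, so finitely many values leave only finitely many cosets. The map \<open>d\<close>
  will be a homomorphism to a finite group, a pair of coset maps, or a table of cocycle
  values.\<close>

lemma finite_indexI:
  assumes N: "subgroup N G" and B: "finite B" "\<And>g. g \<in> carrier G \<Longrightarrow> d g \<in> B"
    and d: "\<And>g h. g \<in> carrier G \<Longrightarrow> h \<in> carrier G \<Longrightarrow> d g = d h \<Longrightarrow> g \<otimes> inv h \<in> N"
  shows "finite_index G N"
proof -
  \<comment> \<open>\<open>r\<close> chooses one preimage of each value; the cosets of these
    preimages are all the cosets.\<close>
  define r where "r b = (SOME g. g \<in> carrier G \<and> d g = b)" for b
  have "N #> g \<in> (\<lambda>b. N #> r b) ` B" if g: "g \<in> carrier G" for g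
  proof
    have r: "r (d g) \<in> carrier G \<and> d (r (d g)) = d g"
      unfolding r_def by (rule someI_ex) (use g in blast)
    then show "N #> g = N #> r (d g)"
      using d g by (simp add: r_coset_eq_iff[OF N])
  qed (use B g in blast)
  then have "rcosets N \<subseteq> (\<lambda>b. N #> r b) ` B"
    by (auto simp: RCOSETS_def)
  then show ?thesis
    unfolding finite_index_def using B(1) by (meson finite_imageI finite_subset)
qed

lemma fin_normal_vimage:
  assumes f: "group_hom G H f" and N: "fin_normal H N"
  shows "fin_normal G {x \<in> carrier G. f x \<in> N}"
proof -
  interpret f: group_hom G H f by fact
  interpret N: normal N H using fin_normalD[OF N] by simp
  have sub: "subgroup {x \<in> carrier G. f x \<in> N} G"
    by (rule subgroupI) auto
  moreover have "{x \<in> carrier G. f x \<in> N} \<lhd> G"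
    by (rule normal_invI[OF sub]) (auto simp: N.inv_op_closed2)
  moreover have "finite_index G {x \<in> carrier G. f x \<in> N}"
  proof (rule finite_indexI[OF sub, where B = "rcosets\<^bsub>H\<^esub> N" and d = "\<lambda>g. N #>\<^bsub>H\<^esub> f g"])
    show "finite (rcosets\<^bsub>H\<^esub> N)" using fin_normalD[OF N] by (simp add: finite_index_def)
    show "N #>\<^bsub>H\<^esub> f g \<in> rcosets\<^bsub>H\<^esub> N" if "g \<in> carrier G" for g
      using that by (auto simp: RCOSETS_def)
  qed (use N.is_subgroup in \<open>auto simp: f.H.r_coset_eq_iff\<close>)
  ultimately show ?thesis by (simp add: fin_normal_def)
qed

lemma fin_normal_Int:
  assumes "fin_normal G M" "fin_normal G N"
  shows "fin_normal G (M \<inter> N)"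
proof -
  note M = fin_normalD[OF assms(1)] and N = fin_normalD[OF assms(2)]
  have "finite_index G (M \<inter> N)"
  proof (rule finite_indexI[where B = "(rcosets M) \<times> (rcosets N)" and d = "\<lambda>g. (M #> g, N #> g)"])
    show "subgroup (M \<inter> N) G" by (rule subgroups_Inter_pair[OF M(2) N(2)])
    show "finite ((rcosets M) \<times> (rcosets N))"
      using M N by (simp add: finite_index_def)
    show "(M #> g, N #> g) \<in> (rcosets M) \<times> (rcosets N)" if "g \<in> carrier G" for g
      using that M N by (simp add: rcosetsI subgroup.subset)
  qed (simp add: r_coset_eq_iff M N)
  then show ?thesis
    by (simp add: fin_normal_def normal_subgroup_intersect M N)
qed

lemma fin_normal_carrier: "fin_normal G (carrier G)"
proof -
  have "finite_index G (carrier G)"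
    by (rule finite_indexI[OF subgroup_self, where B = "{()}" and d = "\<lambda>_. ()"]) auto
  moreover have "carrier G \<lhd> G"
    by (rule normal_invI[OF subgroup_self]) auto
  ultimately show ?thesis by (simp add: fin_normal_def)
qed

text \<open>The factor \<open>carrier G\<close> gives the empty family its correct intersection,
  which would otherwise be the whole type.\<close>

lemma fin_normal_INT:
  assumes "finite I" "\<And>i. i \<in> I \<Longrightarrow> fin_normal G (N i)"
  shows "fin_normal G (carrier G \<inter> (\<Inter>i\<in>I. N i))"
  using assms
proof (induction I)
  case empty
  then show ?case by (simp add: fin_normal_carrier)
next
  case (insert i I)
  have "fin_normal G (N i \<inter> (carrier G \<inter> (\<Inter>i\<in>I. N i)))"
    by (rule fin_normal_Int) (use insert in simp_all)
  then show ?case by (simp add: Int_left_commute)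
qed

section \<open>Characteristic subgroups of finite index in finitely generated groups\<close>

lemma auto_hom:
  assumes "\<phi> \<in> auto G"
  shows "group_hom G G \<phi>"
  using assms by unfold_locales (auto simp: auto_def)

lemma auto_inverse:
  assumes "\<phi> \<in> auto G"
  obtains \<psi> where "\<psi> \<in> auto G" "\<And>x. x \<in> carrier G \<Longrightarrow> \<phi> (\<psi> x) = x"
proof
  let ?\<psi> = "\<lambda>x\<in>carrier G. inv_into (carrier G) \<phi> x"
  have b: "\<phi> \<in> Bij (carrier G)" "\<phi> \<in> hom G G" using assms by (auto simp: auto_def)
  show "?\<psi> \<in> auto G"
    unfolding auto_def using restrict_inv_into_hom[OF b(2,1)] restrict_inv_into_Bij[OF b(1)] by simp
  show "\<phi> (?\<psi> x) = x" if "x \<in> carrier G" for x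
    using that b by (simp add: Bij_def bij_betw_def f_inv_into_f)
qed

text \<open>\<open>K\<close> is the intersection of the kernels of all homomorphisms from
  \<open>G\<close> to \<open>G Mod N\<close>. A homomorphism is determined on
  \<open>carrier G\<close> by its values on a finite generating set, so there are finitely many
  kernels, and precomposition with an automorphism stays within the homomorphisms.\<close>

lemma ex_characteristic_subgroup_below:
  assumes fg: "finitely_generated_group G" and N: "fin_normal G N"
  shows "\<exists>K. characteristic_subgroup K G \<and> finite_index G K \<and> K \<subseteq> N"
proof -
  obtain T where T: "finite T" "T \<subseteq> carrier G" "generate G T = carrier G"
    using fg by (auto simp: finitely_generated_group_def)
  interpret N: normal N G using fin_normalD[OF N] by simp
  let ?Q = "G Mod N"
  interpret Q: group ?Q by (rule N.factorgroup_is_group)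
  have finQ: "finite (carrier ?Q)"
    using fin_normalD(3)[OF N] by (simp add: finite_index_def FactGroup_def)
  \<comment> \<open>Kernels are collected rather than homomorphisms: \<open>hom\<close> leaves the
    values outside the carrier arbitrary, so it need not be a finite set.\<close>
  define F where "F = (kernel G ?Q) ` hom G ?Q"
  have hom: "group_hom G ?Q f" if "f \<in> hom G ?Q" for f
    using that by unfold_locales
  have eq: "kernel G ?Q f = kernel G ?Q f'"
    if "f \<in> hom G ?Q" "f' \<in> hom G ?Q" "restrict f T = restrict f' T" for f f'
  proof -
    interpret f: group_hom G ?Q f using hom that by simp
    interpret f': group_hom G ?Q f' using hom that by simp
    have on_T: "f x = f' x" if "x \<in> T" for x
      using \<open>restrict f T = restrict f' T\<close> that by (metis restrict_apply')
    have "f x = f' x" if "x \<in> generate G T" for x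
      using that
    proof (induction rule: generate.induct)
      case (incl h)
      then show ?case by (rule on_T)
    next
      case (inv h)
      then have "h \<in> carrier G" using T by blast
      then show ?case using on_T[OF inv] by (simp add: f.hom_inv f'.hom_inv)
    next
      case (eng h1 h2)
      then have "h1 \<in> carrier G" "h2 \<in> carrier G" by (simp_all add: T)
      then show ?case using eng by (simp del: mult_FactGroup)
    qed (auto simp del: one_FactGroup)
    then show ?thesis by (auto simp: kernel_def T simp del: one_FactGroup)
  qed
  have "finite F"
  proof -
    \<comment> \<open>Each kernel is recovered from the restriction to \<open>T\<close> of any
      homomorphism having it, whence a surjection onto \<open>F\<close> from the finite set of
      functions from \<open>T\<close> to the quotient.\<close>
    define r where "r p = kernel G ?Q (SOME f. f \<in> hom G ?Q \<and> restrict f T = p)" for p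
    have "F \<subseteq> r ` (T \<rightarrow>\<^sub>E carrier ?Q)"
    proof
      fix K assume "K \<in> F"
      then obtain f where f: "f \<in> hom G ?Q" "K = kernel G ?Q f" by (auto simp: F_def)
      let ?g = "SOME f'. f' \<in> hom G ?Q \<and> restrict f' T = restrict f T"
      have "?g \<in> hom G ?Q \<and> restrict ?g T = restrict f T"
        by (rule someI[of "\<lambda>f'. f' \<in> hom G ?Q \<and> restrict f' T = restrict f T" f]) (use f in simp)
      then have "kernel G ?Q ?g = kernel G ?Q f" by (intro eq) (use f in simp_all)
      then have "K = r (restrict f T)" by (simp only: r_def f(2))
      moreover have "restrict f T \<in> T \<rightarrow>\<^sub>E carrier ?Q"
        using f T by (auto simp: hom_def)
      ultimately show "K \<in> r ` (T \<rightarrow>\<^sub>E carrier ?Q)" by blast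
    qed
    then show ?thesis
      using finQ T by (meson finite_PiE finite_imageI finite_subset)
  qed
  define K where "K = carrier G \<inter> (\<Inter>L\<in>F. L)"
  have "fin_normal G K"
    unfolding K_def
  proof (rule fin_normal_INT[OF \<open>finite F\<close>])
    fix L assume "L \<in> F"
    then obtain f where f: "f \<in> hom G ?Q" "L = kernel G ?Q f" by (auto simp: F_def)
    interpret f: group_hom G ?Q f using hom f by simp
    have "finite_index G L"
      unfolding f(2)
      by (rule finite_indexI[OF f.subgroup_kernel finQ, where d = f])
        (auto simp: kernel_def simp del: one_FactGroup mult_FactGroup)
    then show "fin_normal G L"
      using f.normal_kernel f by (simp add: fin_normal_def)
  qed
  \<comment> \<open>The projection to \<open>G Mod N\<close> is one of the homomorphisms, and its
    kernel is \<open>N\<close>.\<close>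
  have KN: "K \<subseteq> N"
  proof
    fix x assume x: "x \<in> K"
    then have "x \<in> kernel G ?Q (\<lambda>a. N #> a)" and c: "x \<in> carrier G"
      using N.r_coset_hom_Mod by (auto simp: K_def F_def)
    then have "N #> x = N" by (simp add: kernel_def)
    then show "x \<in> N" using rcos_self[OF c N.is_subgroup] by simp
  qed
  have sub: "\<phi> ` K \<subseteq> K" if \<phi>: "\<phi> \<in> auto G" for \<phi>
  proof -
    interpret \<phi>: group_hom G G \<phi> using auto_hom \<phi> .
    have "\<phi> x \<in> kernel G ?Q f" if x: "x \<in> K" and f: "f \<in> hom G ?Q" for x f
    proof -
      have "f \<circ> \<phi> \<in> hom G ?Q" using Group.hom_compose[OF \<phi>.homh f] .
      then have "x \<in> kernel G ?Q (f \<circ> \<phi>)" using x by (auto simp: K_def F_def)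
      then show ?thesis by (simp add: kernel_def)
    qed
    then show ?thesis by (auto simp: K_def F_def)
  qed
  have "\<phi> ` K = K" if \<phi>: "\<phi> \<in> auto G" for \<phi>
  proof
    obtain \<psi> where \<psi>: "\<psi> \<in> auto G" "\<And>x. x \<in> carrier G \<Longrightarrow> \<phi> (\<psi> x) = x"
      using auto_inverse[OF \<phi>] by blast
    show "K \<subseteq> \<phi> ` K"
    proof
      fix x assume x: "x \<in> K"
      then have "\<phi> (\<psi> x) = x" using \<psi>(2) by (simp add: K_def)
      moreover have "\<psi> x \<in> K" using sub[OF \<psi>(1)] x by blast
      ultimately show "x \<in> \<phi> ` K" by (metis imageI)
    qed
  qed (rule sub[OF \<phi>])
  then have "characteristic_subgroup K G"
    using fin_normalD[OF \<open>fin_normal G K\<close>] by (simp add: characteristic_subgroup_def)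
  then show ?thesis
    using fin_normalD(3)[OF \<open>fin_normal G K\<close>] KN by blast
qed

end

section \<open>Outer automorphisms and finite quotients\<close>

lemma finite_auto:
  assumes "finite (carrier G)"
  shows "finite (auto G)"
proof (rule finite_subset)
  show "auto G \<subseteq> carrier G \<rightarrow>\<^sub>E carrier G"
    by (auto simp: auto_def Bij_def hom_def PiE_def)
  show "finite (carrier G \<rightarrow>\<^sub>E carrier G)" using assms by (intro finite_PiE)
qed

context group
begin

lemma carrier_AutoGroup: "carrier (AutoGroup G) = auto G"
  by (simp add: AutoGroup_def)

lemma mult_AutoGroup:
  "\<phi> \<in> auto G \<Longrightarrow> \<psi> \<in> auto G \<Longrightarrow> \<phi> \<otimes>\<^bsub>AutoGroup G\<^esub> \<psi> = compose (carrier G) \<phi> \<psi>"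
  by (simp add: AutoGroup_def BijGroup_def auto_def)

lemma inner_auto_subset_auto: "inner_auto G \<subseteq> auto G"
  using subgroup.subset[OF normal_imp_subgroup[OF normal_inner_auto]]
  by (simp add: carrier_AutoGroup)

text \<open>\<open>Mod\<close> presents its elements as right cosets, which agree with left cosets
  because \<open>K\<close> is normal.\<close>

lemma induced_auto_r_coset:
  assumes "characteristic_subgroup K G" "\<phi> \<in> auto G" "g \<in> carrier G"
  shows "induced_auto G K \<phi> (K #> g) = K #> \<phi> g"
proof -
  interpret normal K G using assms(1) by (rule characteristic_subgroup_normal)
  interpret \<phi>: group_hom G G \<phi> using assms(2) by (rule auto_hom)
  show ?thesis using induced_auto_coset[OF assms] coset_eq assms(3) by simp
qed

lemma induced_auto_hom:
  assumes K: "characteristic_subgroup K G"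
  shows "induced_auto G K \<in> hom (AutoGroup G) (AutoGroup (G Mod K))"
proof (rule homI)
  interpret K: normal K G using K by (rule characteristic_subgroup_normal)
  interpret Q: group "G Mod K" by (rule K.factorgroup_is_group)
  fix \<phi> assume "\<phi> \<in> carrier (AutoGroup G)"
  then have \<phi>: "\<phi> \<in> auto G" by (simp add: carrier_AutoGroup)
  show "induced_auto G K \<phi> \<in> carrier (AutoGroup (G Mod K))"
    by (simp add: Q.carrier_AutoGroup induced_auto_in_auto[OF K \<phi>])
  interpret \<phi>: group_hom G G \<phi> using \<phi> by (rule auto_hom)
  fix \<psi> assume "\<psi> \<in> carrier (AutoGroup G)"
  then have \<psi>: "\<psi> \<in> auto G" by (simp add: carrier_AutoGroup)
  interpret \<psi>: group_hom G G \<psi> using \<psi> by (rule auto_hom)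
  have c: "compose (carrier G) \<phi> \<psi> \<in> auto G"
    using group.is_monoid[OF AutoGroup, THEN monoid.m_closed, of \<phi> \<psi>] \<phi> \<psi>
    by (simp add: carrier_AutoGroup mult_AutoGroup)
  have "induced_auto G K (compose (carrier G) \<phi> \<psi>)
      = compose (carrier (G Mod K)) (induced_auto G K \<phi>) (induced_auto G K \<psi>)" (is "?l = ?r")
  proof (rule extensionalityI)
    show "?l C = ?r C" if C: "C \<in> carrier (G Mod K)" for C
    proof -
      obtain g where "g \<in> carrier G" "C = K #> g"
        using C by (auto simp: carrier_FactGroup)
      with C show ?thesis
        using induced_auto_r_coset[OF K] c \<phi> \<psi> by (simp add: compose_eq)
    qed
  qed (simp_all add: induced_auto_def)
  then show "induced_auto G K (\<phi> \<otimes>\<^bsub>AutoGroup G\<^esub> \<psi>)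
      = induced_auto G K \<phi> \<otimes>\<^bsub>AutoGroup (G Mod K)\<^esub> induced_auto G K \<psi>"
    using \<phi> \<psi> induced_auto_in_auto[OF K] by (simp add: mult_AutoGroup Q.mult_AutoGroup)
qed

text \<open>Conjugation by \<open>a\<close> descends to conjugation by the coset of
  \<open>a\<close>. Hence the map between automorphism groups passes to outer automorphism
  groups.\<close>

lemma induced_auto_inner:
  assumes K: "characteristic_subgroup K G" and \<phi>: "\<phi> \<in> inner_auto G"
  shows "induced_auto G K \<phi> \<in> inner_auto (G Mod K)"
proof -
  interpret K: normal K G using K by (rule characteristic_subgroup_normal)
  obtain a where a: "a \<in> carrier G" and \<phi>_eq: "\<phi> = (\<lambda>x\<in>carrier G. a \<otimes> x \<otimes> inv a)"
    using \<phi> by (auto simp: inner_auto_def)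
  have \<phi>_auto: "\<phi> \<in> auto G" using \<phi> inner_auto_subset_auto by blast
  let ?q = "\<lambda>a. K #> a"
  interpret q: group_hom G "G Mod K" ?q
    by (intro group_hom.intro group_hom_axioms.intro K.factorgroup_is_group is_group K.r_coset_hom_Mod)
  have "induced_auto G K \<phi> = (\<lambda>C\<in>carrier (G Mod K).
      ?q a \<otimes>\<^bsub>G Mod K\<^esub> C \<otimes>\<^bsub>G Mod K\<^esub> inv\<^bsub>G Mod K\<^esub> ?q a)" (is "?l = ?r")
  proof (rule extensionalityI)
    show "?l C = ?r C" if C: "C \<in> carrier (G Mod K)" for C
    proof -
      obtain g where g: "g \<in> carrier G" "C = ?q g"
        using C by (auto simp: carrier_FactGroup)
      have "?l C = ?q (a \<otimes> g \<otimes> inv a)"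
        using g induced_auto_r_coset[OF K \<phi>_auto] by (simp add: \<phi>_eq)
      also have "\<dots> = ?r C"
        using C a g q.hom_mult[of "a \<otimes> g" "inv a"] q.hom_mult[of a g] q.hom_inv[of a] by simp
      finally show ?thesis .
    qed
  qed (simp_all add: induced_auto_def)
  then show ?thesis
    using a by (force simp: inner_auto_def carrier_FactGroup)
qed

text \<open>A nontrivial outer class is represented by a non-inner \<phi>. Separability yields
  \<open>K\<close> for which the class of \<phi> survives in \<open>Out (G Mod K)\<close>, a finite
  group because \<open>K\<close> has finite index. The kernel of the induced map
  \<open>Out G\<close> \<rightarrow> \<open>Out (G Mod K)\<close> then separates the class from the
  identity.\<close>

lemma Out_residually_finite:
  assumes "inner_automorphism_separable G"
  shows "residually_finite (Out G)"
  unfolding residually_finite_alt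
proof
  fix C assume C: "C \<in> carrier (Out G) - {\<one>\<^bsub>Out G\<^esub>}"
  interpret A: group "AutoGroup G" by (rule AutoGroup)
  interpret I: normal "inner_auto G" "AutoGroup G" by (rule normal_inner_auto)
  obtain \<phi> where \<phi>: "\<phi> \<in> auto G" "C = inner_auto G #>\<^bsub>AutoGroup G\<^esub> \<phi>"
    using C by (auto simp: Out_def carrier_FactGroup carrier_AutoGroup)
  have "\<phi> \<notin> inner_auto G"
    using C \<phi> I.rcos_const[OF A.is_group] by (auto simp: Out_def)
  then obtain K where K: "characteristic_subgroup K G" "finite_index G K"
    and ni: "induced_auto G K \<phi> \<notin> inner_auto (G Mod K)"
    using assms \<phi> unfolding inner_automorphism_separable_def by blast
  interpret K: normal K G using K(1) by (rule characteristic_subgroup_normal)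
  let ?Q = "G Mod K"
  interpret Q: group ?Q by (rule K.factorgroup_is_group)
  interpret AQ: group "AutoGroup ?Q" by (rule Q.AutoGroup)
  interpret IQ: normal "inner_auto ?Q" "AutoGroup ?Q" by (rule Q.normal_inner_auto)
  interpret OQ: group "Out ?Q" by (rule Q.group_Out)
  let ?h = "(\<lambda>\<psi>. inner_auto ?Q #>\<^bsub>AutoGroup ?Q\<^esub> \<psi>) \<circ> induced_auto G K"
  have hom: "?h \<in> hom (AutoGroup G) (Out ?Q)"
    unfolding Out_def by (rule Group.hom_compose[OF induced_auto_hom[OF K(1)] IQ.r_coset_hom_Mod])
  interpret h: group_hom "AutoGroup G" "Out ?Q" ?h by unfold_locales (rule hom)
  have one: "\<one>\<^bsub>Out ?Q\<^esub> = inner_auto ?Q" by (simp add: Out_def)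
  have "inner_auto G \<subseteq> kernel (AutoGroup G) (Out ?Q) ?h"
  proof
    fix \<psi> assume \<psi>: "\<psi> \<in> inner_auto G"
    then have "?h \<psi> = \<one>\<^bsub>Out ?Q\<^esub>"
      using IQ.rcos_const[OF AQ.is_group] induced_auto_inner[OF K(1)] by (simp add: one)
    then show "\<psi> \<in> kernel (AutoGroup G) (Out ?Q) ?h"
      using I.subset \<psi> by (auto simp: kernel_def)
  qed
  \<comment> \<open>Inner automorphisms die under \<open>?h\<close>, so \<open>?h\<close> factors
    through \<open>Out G\<close>.\<close>
  then obtain f where f: "f \<in> hom (Out G) (Out ?Q)"
    "\<And>\<psi>. \<psi> \<in> auto G \<Longrightarrow> f (inner_auto G #>\<^bsub>AutoGroup G\<^esub> \<psi>) = ?h \<psi>"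
    using h.FactGroup_universal_kernel[OF normal_inner_auto]
    by (metis Out_def carrier_AutoGroup)
  interpret O: group "Out G" by (rule group_Out)
  interpret f: group_hom "Out G" "Out ?Q" f by unfold_locales (rule f)
  have "finite (carrier ?Q)"
    using K(2) by (simp add: finite_index_def FactGroup_def)
  then have "finite (carrier (Out ?Q))"
    by (simp add: Out_def carrier_FactGroup Q.carrier_AutoGroup finite_auto)
  then have "finite_index (Out G) (kernel (Out G) (Out ?Q) f)"
    by (rule O.finite_indexI[OF f.subgroup_kernel, where d = f]) (auto simp: kernel_def)
  moreover have "f C \<noteq> \<one>\<^bsub>Out ?Q\<^esub>"
  proof
    assume "f C = \<one>\<^bsub>Out ?Q\<^esub>"
    then have "inner_auto ?Q #>\<^bsub>AutoGroup ?Q\<^esub> induced_auto G K \<phi> = inner_auto ?Q"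
      using f(2) \<phi> by (simp add: one)
    then show False
      using ni AQ.rcos_self[OF _ IQ.is_subgroup, of "induced_auto G K \<phi>"] induced_auto_in_auto[OF K(1) \<phi>(1)]
      by (simp add: Q.carrier_AutoGroup)
  qed
  ultimately show "\<exists>N. fin_normal (Out G) N \<and> C \<notin> N"
    using f.normal_kernel by (intro exI[of _ "kernel (Out G) (Out ?Q) f"]) (auto simp: fin_normal_def kernel_def)
qed

end

section \<open>The universal property of graph products\<close>

text \<open>The family \<open>h\<close> is a parameter because evaluation serves twice: to define
  maps out of a free product and, with \<open>incl\<close> for \<open>h\<close>, to name the
  elements of a graph product.\<close>

definition word_val :: "('b, 'n) monoid_scheme \<Rightarrow> ('i \<Rightarrow> 'a \<Rightarrow> 'b) \<Rightarrow> ('i \<times> 'a) list \<Rightarrow> 'b" where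
  "word_val K h w = foldr (\<lambda>(i, a) r. h i a \<otimes>\<^bsub>K\<^esub> r) w \<one>\<^bsub>K\<^esub>"

lemma word_val_Nil [simp]: "word_val K h [] = \<one>\<^bsub>K\<^esub>"
  by (simp add: word_val_def)

lemma word_val_Cons [simp]: "word_val K h ((i, a) # w) = h i a \<otimes>\<^bsub>K\<^esub> word_val K h w"
  by (simp add: word_val_def)

text \<open>Evaluation of words in \<open>K\<close> is unchanged by deleting an identity letter and
  by merging two letters of one factor, so it is constant on the classes of
  \<open>free_product_rel\<close>.\<close>

lemma free_product_universal:
  fixes G :: "'i \<Rightarrow> ('a, 'm) monoid_scheme" and K :: "('b, 'n) monoid_scheme"
  assumes grp: "\<And>i. i \<in> I \<Longrightarrow> group (G i)" and K: "group K"
    and h: "\<And>i. i \<in> I \<Longrightarrow> h i \<in> hom (G i) K"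
  obtains f where "f \<in> hom (free_product I G) K"
    "\<And>i a. i \<in> I \<Longrightarrow> a \<in> carrier (G i) \<Longrightarrow> f (free_product_incl I G i a) = h i a"
proof -
  interpret K: group K by fact
  let ?W = "free_product_words I G" and ?R = "free_product_rel I G" and ?F = "free_product I G"
  let ?val = "word_val K h"
  have h_closed: "h i a \<in> carrier K" if "i \<in> I" "a \<in> carrier (G i)" for i a
    using h that by (auto simp: hom_def)
  have val_closed: "?val w \<in> carrier K" if "w \<in> ?W" for w
    using that by (induction w) (auto simp: free_product_words_def h_closed)
  have val_append: "?val (x @ y) = ?val x \<otimes>\<^bsub>K\<^esub> ?val y" if "x \<in> ?W" "y \<in> ?W" for x y
    using that(1)
  proof (induction x)
    case (Cons p x)
    then show ?case
      using val_closed[of x] val_closed[OF that(2)]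
      by (cases p) (auto simp: free_product_words_def h_closed K.m_assoc)
  qed (simp add: val_closed that)
  have val_rel: "?val w = ?val w'" if "(w, w') \<in> ?R" for w w'
    using that
  proof (induction rule: free_product_rel.induct)
    case (delete x y i)
    interpret Gi: group "G i" using grp delete by simp
    interpret hi: group_hom "G i" K "h i" by unfold_locales (rule h[OF delete(3)])
    have "[(i, \<one>\<^bsub>G i\<^esub>)] @ y \<in> ?W" using delete by (simp add: free_product_words_def)
    then show ?case using delete by (simp add: val_append val_closed del: append.simps) (simp add: val_closed)
  next
    case (merge x y i g k)
    interpret Gi: group "G i" using grp merge by simp
    interpret hi: group_hom "G i" K "h i" by unfold_locales (rule h[OF merge(3)])
    have "[(i, g), (i, k)] @ y \<in> ?W" "[(i, g \<otimes>\<^bsub>G i\<^esub> k)] @ y \<in> ?W"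
      using merge by (simp_all add: free_product_words_def)
    then show ?case using merge
      by (simp add: val_append val_closed del: append.simps) (simp add: val_closed K.m_assoc)
  qed auto
  have carr: "carrier ?F = {?R `` {w} |w. w \<in> ?W}"
    by (rule free_product_carrier) (rule grp)
  have mult: "?R `` {a} \<otimes>\<^bsub>?F\<^esub> ?R `` {b} = ?R `` {a @ b}" if "a \<in> ?W" "b \<in> ?W" for a b
    by (rule free_product_mult) (rule grp, use that in simp_all)
  \<comment> \<open>The chosen representative is immaterial, by \<open>val_rel\<close>.\<close>
  define f where "f C = ?val (SOME w. w \<in> C)" for C
  have f: "f (?R `` {w}) = ?val w" if "w \<in> ?W" for w
  proof -
    have "(SOME w'. w' \<in> ?R `` {w}) \<in> ?R `` {w}"
      by (rule someI[of _ w]) (use that in \<open>auto intro: free_product_rel.refl\<close>)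
    then show ?thesis using val_rel by (simp add: f_def)
  qed
  show ?thesis
  proof
    show "f \<in> hom ?F K"
    proof (rule homI)
      fix A B assume "A \<in> carrier ?F" "B \<in> carrier ?F"
      then obtain a b where ab: "a \<in> ?W" "b \<in> ?W" and [simp]: "A = ?R `` {a}" "B = ?R `` {b}"
        unfolding carr by auto
      show "f A \<in> carrier K" using ab by (simp add: f val_closed)
      have "a @ b \<in> ?W" using ab by (simp add: free_product_words_def)
      then show "f (A \<otimes>\<^bsub>?F\<^esub> B) = f A \<otimes>\<^bsub>K\<^esub> f B"
        using ab by (simp add: mult f val_append)
    qed
    show "f (free_product_incl I G i a) = h i a" if "i \<in> I" "a \<in> carrier (G i)" for i a
    proof -
      have "[(i, a)] \<in> ?W" using that by (simp add: free_product_words_def)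
      then show ?thesis
        unfolding free_product_incl_def by (simp only: f) (use that h_closed in simp)
    qed
  qed
qed

section \<open>The graph product, its canonical maps from the vertex groups, and maps out of
  it\<close>

locale vertex_groups =
  fixes V :: "'v set" and E :: "'v set set" and G :: "'v \<Rightarrow> ('a, 'm) monoid_scheme"
  assumes simplicial: "simplicial_graph V E" and grp: "\<And>v. v \<in> V \<Longrightarrow> group (G v)"
begin

abbreviation P where "P \<equiv> graph_product V E G"

abbreviation relator_closure where
  "relator_closure \<equiv> normal_closure (free_product V G) (graph_product_relators V E G)"

definition incl :: "'v \<Rightarrow> 'a \<Rightarrow> ('v \<times> 'a) list set set" where
  "incl v a = relator_closure #>\<^bsub>free_product V G\<^esub> free_product_incl V G v a"

abbreviation val where "val \<equiv> word_val P incl"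

definition words :: "'v set \<Rightarrow> ('v \<times> 'a) list set" where
  "words S = lists (SIGMA v:S. carrier (G v))"

lemma words_Nil [simp]: "[] \<in> words S"
  by (simp add: words_def)

lemma words_Cons [simp]:
  "(v, a) # w \<in> words S \<longleftrightarrow> v \<in> S \<and> a \<in> carrier (G v) \<and> w \<in> words S"
  by (auto simp: words_def)

lemma words_append [simp]: "x @ y \<in> words S \<longleftrightarrow> x \<in> words S \<and> y \<in> words S"
  by (auto simp: words_def)

lemma words_mono: "S \<subseteq> T \<Longrightarrow> w \<in> words S \<Longrightarrow> w \<in> words T"
  by (auto simp: words_def)

sublocale P: group P
  by (rule group_graph_product) (rule simplicial, rule grp)

lemma edge_in_V: "{u, v} \<in> E \<Longrightarrow> u \<in> V \<and> v \<in> V \<and> u \<noteq> v"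
proof -
  assume "{u, v} \<in> E"
  then have "{u, v} \<subseteq> V" "card {u, v} = 2"
    using simplicial by (auto simp: simplicial_graph_def)
  then show ?thesis by (cases "u = v") auto
qed

lemma group_F: "group (free_product V G)"
  by (rule group_free_product) (rule grp)

lemma free_incl_closed:
  "v \<in> V \<Longrightarrow> a \<in> carrier (G v) \<Longrightarrow> free_product_incl V G v a \<in> carrier (free_product V G)"
  using free_product_incl_hom[of V G v, OF grp] by (blast intro: hom_in_carrier)

lemma relators_subset: "graph_product_relators V E G \<subseteq> carrier (free_product V G)"
proof -
  interpret F: group "free_product V G" by (rule group_F)
  show ?thesis
    by (auto simp: graph_product_relators_def intro!: F.m_closed F.inv_closed free_incl_closed dest: edge_in_V)
qed

lemma normal_relator_closure: "relator_closure \<lhd> free_product V G"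
  by (rule group.normal_normal_closure[OF group_F relators_subset])

lemma incl_group_hom: "v \<in> V \<Longrightarrow> group_hom (G v) P (incl v)"
proof -
  assume v: "v \<in> V"
  have "(\<lambda>x. relator_closure #>\<^bsub>free_product V G\<^esub> x) \<circ> free_product_incl V G v \<in> hom (G v) P"
    unfolding graph_product_def
    by (rule Group.hom_compose[OF free_product_incl_hom normal.r_coset_hom_Mod[OF normal_relator_closure]])
      (use v grp in auto)
  moreover have "incl v = (\<lambda>x. relator_closure #>\<^bsub>free_product V G\<^esub> x) \<circ> free_product_incl V G v"
    by (simp add: fun_eq_iff incl_def)
  ultimately show ?thesis
    using grp[OF v] P.is_group by (simp add: group_hom_def group_hom_axioms_def)
qed

lemma incl_closed [simp]: "v \<in> V \<Longrightarrow> a \<in> carrier (G v) \<Longrightarrow> incl v a \<in> carrier P"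
  using group_hom.hom_closed[OF incl_group_hom] .

lemma incl_commute:
  assumes uv: "{u, v} \<in> E" and a: "a \<in> carrier (G u)" and b: "b \<in> carrier (G v)"
  shows "incl u a \<otimes>\<^bsub>P\<^esub> incl v b = incl v b \<otimes>\<^bsub>P\<^esub> incl u a"
proof -
  interpret F: group "free_product V G" by (rule group_F)
  interpret N: normal relator_closure "free_product V G" by (rule normal_relator_closure)
  let ?i = "free_product_incl V G"
  have c: "?i u a \<in> carrier (free_product V G)" "?i v b \<in> carrier (free_product V G)"
    using assms edge_in_V[OF uv] by (auto intro: free_incl_closed)
  have "(?i u a \<otimes>\<^bsub>free_product V G\<^esub> ?i v b) \<otimes>\<^bsub>free_product V G\<^esub>
      inv\<^bsub>free_product V G\<^esub> (?i v b \<otimes>\<^bsub>free_product V G\<^esub> ?i u a) \<in> graph_product_relators V E G"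
    using assms unfolding graph_product_relators_def by blast
  then have "(?i u a \<otimes>\<^bsub>free_product V G\<^esub> ?i v b) \<otimes>\<^bsub>free_product V G\<^esub>
      inv\<^bsub>free_product V G\<^esub> (?i v b \<otimes>\<^bsub>free_product V G\<^esub> ?i u a) \<in> relator_closure"
    by (auto simp: normal_closure_def)
  then show ?thesis
    using c F.r_coset_eq_iff[OF N.is_subgroup] N.rcos_sum
    by (simp add: incl_def graph_product_def)
qed

text \<open>The commutation hypothesis puts all relators into the kernel of the map induced on the
  free product. The kernel is normal and so contains their normal closure, and the map factors
  through the quotient.\<close>

lemma graph_product_universal:
  fixes K :: "('b, 'n) monoid_scheme"
  assumes K: "group K" and h: "\<And>v. v \<in> V \<Longrightarrow> h v \<in> hom (G v) K"
    and comm: "\<And>u v a b. {u, v} \<in> E \<Longrightarrow> a \<in> carrier (G u) \<Longrightarrow> b \<in> carrier (G v) \<Longrightarrow>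
      h u a \<otimes>\<^bsub>K\<^esub> h v b = h v b \<otimes>\<^bsub>K\<^esub> h u a"
  obtains f where "group_hom P K f"
    "\<And>v a. v \<in> V \<Longrightarrow> a \<in> carrier (G v) \<Longrightarrow> f (incl v a) = h v a"
proof -
  let ?F = "free_product V G"
  obtain f where f: "f \<in> hom ?F K"
    "\<And>v a. v \<in> V \<Longrightarrow> a \<in> carrier (G v) \<Longrightarrow> f (free_product_incl V G v a) = h v a"
    using free_product_universal[of V G K h] grp K h by blast
  interpret f: group_hom ?F K f
    using K f(1) group_F by (simp add: group_hom_def group_hom_axioms_def)
  have "graph_product_relators V E G \<subseteq> kernel ?F K f"
  proof
    fix r assume r: "r \<in> graph_product_relators V E G"
    then obtain u v a b where uv: "{u, v} \<in> E" "a \<in> carrier (G u)" "b \<in> carrier (G v)"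
      and r_eq: "r = (free_product_incl V G u a \<otimes>\<^bsub>?F\<^esub> free_product_incl V G v b) \<otimes>\<^bsub>?F\<^esub>
        inv\<^bsub>?F\<^esub> (free_product_incl V G v b \<otimes>\<^bsub>?F\<^esub> free_product_incl V G u a)"
      by (auto simp: graph_product_relators_def)
    note V = edge_in_V[OF uv(1)]
    have c: "free_product_incl V G u a \<in> carrier ?F" "free_product_incl V G v b \<in> carrier ?F"
      using uv V by (auto intro: free_incl_closed)
    then have "f r = (h u a \<otimes>\<^bsub>K\<^esub> h v b) \<otimes>\<^bsub>K\<^esub> inv\<^bsub>K\<^esub> (h v b \<otimes>\<^bsub>K\<^esub> h u a)"
      unfolding r_eq using uv V by (simp add: f del: f.G.inv_mult_group f.H.inv_mult_group)
    also have "\<dots> = \<one>\<^bsub>K\<^esub>"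
    proof -
      have "h u a \<in> carrier K" "h v b \<in> carrier K" using h uv V by (auto simp: hom_def)
      then show ?thesis unfolding comm[OF uv] by simp
    qed
    finally show "r \<in> kernel ?F K f" using r relators_subset by (auto simp: kernel_def)
  qed
  then have "relator_closure \<subseteq> kernel ?F K f"
    using f.normal_kernel by (auto simp: normal_closure_def)
  then obtain g where g: "g \<in> hom P K"
    "\<And>x. x \<in> carrier ?F \<Longrightarrow> g (relator_closure #>\<^bsub>?F\<^esub> x) = f x"
    using f.FactGroup_universal_kernel[OF normal_relator_closure] unfolding graph_product_def by blast
  show ?thesis
  proof
    show "group_hom P K g" using g K P.is_group by (simp add: group_hom_def group_hom_axioms_def)
    show "g (incl v a) = h v a" if "v \<in> V" "a \<in> carrier (G v)" for v a
      using that g(2)[OF free_incl_closed] f(2) by (simp add: incl_def)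
  qed
qed

section \<open>Elements of the graph product as values of words\<close>

lemma val_closed: "S \<subseteq> V \<Longrightarrow> w \<in> words S \<Longrightarrow> val w \<in> carrier P"
  by (induction w) (auto simp: subset_iff)

lemma val_closed_V [simp]: "w \<in> words V \<Longrightarrow> val w \<in> carrier P"
  by (rule val_closed[OF order_refl])

lemma val_append: "S \<subseteq> V \<Longrightarrow> x \<in> words S \<Longrightarrow> y \<in> words S \<Longrightarrow> val (x @ y) = val x \<otimes>\<^bsub>P\<^esub> val y"
proof (induction x)
  case (Cons p x)
  then show ?case
    using val_closed[of S x] val_closed[of S y]
    by (cases p) (auto simp: P.m_assoc subset_iff)
qed (simp add: val_closed)

lemma ex_word: "x \<in> carrier P \<Longrightarrow> \<exists>w \<in> words V. x = val w"
proof -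
  interpret F: group "free_product V G" by (rule group_F)
  interpret N: normal relator_closure "free_product V G" by (rule normal_relator_closure)
  have carr: "carrier (free_product V G)
      = {free_product_rel V G `` {w} |w. w \<in> free_product_words V G}"
    by (rule free_product_carrier) (rule grp)
  assume "x \<in> carrier P"
  then obtain y where y: "y \<in> carrier (free_product V G)" "x = relator_closure #>\<^bsub>free_product V G\<^esub> y"
    by (auto simp: graph_product_def carrier_FactGroup)
  obtain w where w: "w \<in> words V" "y = free_product_rel V G `` {w}"
    using y(1) unfolding carr by (auto simp: free_product_words_def words_def)
  \<comment> \<open>The class of a word in the free product is the product of the classes of its
    letters, each of which projects to the corresponding \<open>incl\<close>.\<close>
  have "relator_closure #>\<^bsub>free_product V G\<^esub> (free_product_rel V G `` {w}) = val w"
    using w(1)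
  proof (induction w rule: list.induct)
    case Nil
    have "free_product_rel V G `` {[]} = \<one>\<^bsub>free_product V G\<^esub>" by (simp add: free_product_def)
    then show ?case using N.subset by (simp add: graph_product_def)
  next
    case (Cons p w)
    obtain v a where p: "p = (v, a)" by (cases p)
    have va: "v \<in> V" "a \<in> carrier (G v)" and w: "w \<in> words V" using Cons.prems p by auto
    have "free_product_incl V G v a \<otimes>\<^bsub>free_product V G\<^esub> free_product_rel V G `` {w}
        = free_product_rel V G `` {[(v, a)] @ w}"
      unfolding free_product_incl_def
      by (rule free_product_mult) (use grp va w in \<open>auto simp: free_product_words_def words_def\<close>)
    moreover have "free_product_rel V G `` {w} \<in> carrier (free_product V G)"
      using w unfolding carr by (auto simp: free_product_words_def words_def)
    ultimately have "relator_closure #>\<^bsub>free_product V G\<^esub> (free_product_rel V G `` {(v, a) # w})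
        = incl v a \<otimes>\<^bsub>P\<^esub> (relator_closure #>\<^bsub>free_product V G\<^esub> (free_product_rel V G `` {w}))"
      using N.rcos_sum[OF free_incl_closed[OF va], of "free_product_rel V G `` {w}"]
      by (simp add: incl_def graph_product_def)
    then show ?case using Cons.IH[OF w] by (simp add: p)
  qed
  then show ?thesis using y(2) w by auto
qed

end

section \<open>Cocycles on graph products\<close>

context vertex_groups
begin

definition star :: "'v \<Rightarrow> 'v set" where
  "star v = insert v {w. {v, w} \<in> E}"

lemma star_subset: "v \<in> V \<Longrightarrow> star v \<subseteq> V"
  by (auto simp: star_def dest: edge_in_V)

text \<open>This is the full subgroup \<langle>S\<rangle>. It is described by words because
  retractions and cocycles are computed syllable by syllable.\<close>

definition sub :: "'v set \<Rightarrow> ('v \<times> 'a) list set set set" where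
  "sub S = val ` words S"

lemma incl_one: "v \<in> V \<Longrightarrow> incl v \<one>\<^bsub>G v\<^esub> = \<one>\<^bsub>P\<^esub>"
  using group_hom.hom_one[OF incl_group_hom] .

lemma incl_mult:
  "v \<in> V \<Longrightarrow> a \<in> carrier (G v) \<Longrightarrow> b \<in> carrier (G v) \<Longrightarrow>
    incl v (a \<otimes>\<^bsub>G v\<^esub> b) = incl v a \<otimes>\<^bsub>P\<^esub> incl v b"
  using group_hom.hom_mult[OF incl_group_hom] by blast

lemma incl_inv:
  "v \<in> V \<Longrightarrow> a \<in> carrier (G v) \<Longrightarrow> incl v (inv\<^bsub>G v\<^esub> a) = inv\<^bsub>P\<^esub> incl v a"
  using group_hom.hom_inv[OF incl_group_hom] by blast

lemma incl_in_sub: "S \<subseteq> V \<Longrightarrow> v \<in> S \<Longrightarrow> a \<in> carrier (G v) \<Longrightarrow> incl v a \<in> sub S"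
  unfolding sub_def by (rule image_eqI[of _ _ "[(v, a)]"]) auto

lemma sub_subgroup:
  assumes S: "S \<subseteq> V"
  shows "subgroup (sub S) P"
proof (rule P.subgroupI)
  show "sub S \<subseteq> carrier P" using S val_closed by (auto simp: sub_def)
  show "sub S \<noteq> {}" unfolding sub_def image_is_empty by (rule ex_in_conv[THEN iffD1]) (rule exI, rule words_Nil)
  show mult: "x \<otimes>\<^bsub>P\<^esub> y \<in> sub S" if "x \<in> sub S" "y \<in> sub S" for x y
    using that val_append[OF S] unfolding sub_def by (auto intro!: image_eqI)
  show "inv\<^bsub>P\<^esub> x \<in> sub S" if "x \<in> sub S" for x
  proof -
    have "inv\<^bsub>P\<^esub> val w \<in> sub S" if "w \<in> words S" for w
      using that
    proof (induction w rule: list.induct)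
      case Nil
      have "val [] \<in> sub S" unfolding sub_def by (rule imageI) simp
      then show ?case by simp
    next
      case (Cons p w)
      obtain v a where p: "p = (v, a)" by (cases p)
      have va: "v \<in> S" "a \<in> carrier (G v)" and w: "w \<in> words S" using Cons.prems p by auto
      have "inv\<^bsub>G v\<^esub> a \<in> carrier (G v)" using grp va S by (auto intro: group.inv_closed)
      then have "inv\<^bsub>P\<^esub> val w \<otimes>\<^bsub>P\<^esub> incl v (inv\<^bsub>G v\<^esub> a) \<in> sub S"
        using Cons.IH w va S by (intro mult incl_in_sub)
      then show ?case
        using va w S val_closed[OF S w] by (simp add: p incl_inv P.inv_mult_group subset_iff)
    qed
    then show ?thesis using that by (auto simp: sub_def)
  qed
qed

lemma sub_V: "sub V = carrier P"
  using ex_word by (auto simp: sub_def)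

lemma hom_eqI:
  assumes "group_hom P K f" "group_hom P K f'"
    and eq: "\<And>v a. v \<in> V \<Longrightarrow> a \<in> carrier (G v) \<Longrightarrow> f (incl v a) = f' (incl v a)"
    and x: "x \<in> carrier P"
  shows "f x = f' x"
proof -
  interpret f: group_hom P K f by fact
  interpret f': group_hom P K f' by fact
  obtain w where w: "w \<in> words V" "x = val w" using ex_word[OF x] by blast
  have "f (val w) = f' (val w)"
    using w(1) by (induction w rule: list.induct) (auto simp: eq)
  then show ?thesis using w by simp
qed

text \<open>Within the graph product, \<open>D\<close> is a union of cosets \<langle>star
  v\<rangle>x; it suffices to ask this for the generators of \<langle>star v\<rangle>.\<close>

definition star_invariant :: "'v \<Rightarrow> ('v \<times> 'a) list set set set \<Rightarrow> bool" where
  "star_invariant v D \<longleftrightarrow> (\<forall>w \<in> star v. \<forall>a \<in> carrier (G w). \<forall>x \<in> carrier P.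
     incl w a \<otimes>\<^bsub>P\<^esub> x \<in> D \<longleftrightarrow> x \<in> D)"

text \<open>When a word for \<open>g\<close> is read from right to left, starting at the point
  \<open>x\<close> and moving the point along, \<open>c g x\<close> is the product of those
  \<open>v\<close>-syllables that are read while the point lies in \<open>D\<close>.\<close>

definition cocycle ::
    "'v \<Rightarrow> ('v \<times> 'a) list set set set \<Rightarrow> (('v \<times> 'a) list set set \<Rightarrow> ('v \<times> 'a) list set set \<Rightarrow> 'a) \<Rightarrow> bool" where
  "cocycle v D c \<longleftrightarrow>
     (\<forall>g \<in> carrier P. \<forall>x \<in> carrier P. c g x \<in> carrier (G v)) \<and>
     (\<forall>g \<in> carrier P. \<forall>h \<in> carrier P. \<forall>x \<in> carrier P.
        c (g \<otimes>\<^bsub>P\<^esub> h) x = c g (h \<otimes>\<^bsub>P\<^esub> x) \<otimes>\<^bsub>G v\<^esub> c h x) \<and>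
     (\<forall>w \<in> V. \<forall>a \<in> carrier (G w). \<forall>x \<in> carrier P.
        c (incl w a) x = (if w = v \<and> x \<in> D then a else \<one>\<^bsub>G v\<^esub>))"

text \<open>A cocycle is a homomorphism into the unrestricted wreath product of \<open>G v\<close> and the graph
  product whose second component is the identity.\<close>

lemma ex_cocycle:
  assumes v: "v \<in> V" and D: "star_invariant v D"
  shows "\<exists>c. cocycle v D c"
proof -
  interpret Gv: group "G v" using grp v .
  \<comment> \<open>The multiplication is chosen so that the first component of a homomorphism with
    identity second component satisfies exactly the cocycle law.\<close>
  define K where "K = \<lparr>carrier = (carrier P \<rightarrow>\<^sub>E carrier (G v)) \<times> carrier P,
    monoid.mult = \<lambda>(F, g) (F', g'). (\<lambda>x\<in>carrier P. F (g' \<otimes>\<^bsub>P\<^esub> x) \<otimes>\<^bsub>G v\<^esub> F' x, g \<otimes>\<^bsub>P\<^esub> g'),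
    one = (\<lambda>x\<in>carrier P. \<one>\<^bsub>G v\<^esub>, \<one>\<^bsub>P\<^esub>)\<rparr>"
  have K: "group K"
  proof (rule groupI)
    fix p q r assume p: "p \<in> carrier K" and q: "q \<in> carrier K" and r: "r \<in> carrier K"
    show "p \<otimes>\<^bsub>K\<^esub> q \<in> carrier K" using p q by (auto simp: K_def PiE_iff)
    show "p \<otimes>\<^bsub>K\<^esub> q \<otimes>\<^bsub>K\<^esub> r = p \<otimes>\<^bsub>K\<^esub> (q \<otimes>\<^bsub>K\<^esub> r)"
      using p q r by (auto simp: K_def PiE_iff fun_eq_iff P.m_assoc Gv.m_assoc)
  next
    show "\<one>\<^bsub>K\<^esub> \<in> carrier K" by (auto simp: K_def)
  next
    fix p assume p: "p \<in> carrier K"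
    show "\<one>\<^bsub>K\<^esub> \<otimes>\<^bsub>K\<^esub> p = p"
      using p by (auto simp: K_def PiE_iff fun_eq_iff extensional_def)
    obtain F g where Fg: "p = (F, g)" "F \<in> carrier P \<rightarrow>\<^sub>E carrier (G v)" "g \<in> carrier P"
      using p by (auto simp: K_def)
    let ?q = "(\<lambda>x\<in>carrier P. inv\<^bsub>G v\<^esub> F (inv\<^bsub>P\<^esub> g \<otimes>\<^bsub>P\<^esub> x), inv\<^bsub>P\<^esub> g)"
    have "?q \<in> carrier K" using Fg by (auto simp: K_def PiE_iff)
    moreover have "?q \<otimes>\<^bsub>K\<^esub> p = \<one>\<^bsub>K\<^esub>"
      using Fg by (auto simp: K_def PiE_iff fun_eq_iff P.m_assoc[symmetric])
    ultimately show "\<exists>q\<in>carrier K. q \<otimes>\<^bsub>K\<^esub> p = \<one>\<^bsub>K\<^esub>" by blast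
  qed
  interpret K: group K by (rule K)
  define h where "h w a = (\<lambda>x\<in>carrier P. if w = v \<and> x \<in> D then a else \<one>\<^bsub>G v\<^esub>, incl w a)" for w a
  \<comment> \<open>Invariance under \<langle>star v\<rangle> enters here: letters of
    \<open>v\<close> must not move a point into or out of \<open>D\<close> for \<open>h v\<close> to
    be multiplicative, and letters of neighbours of \<open>v\<close> must not for \<open>h\<close>
    to respect the edges at \<open>v\<close>.\<close>
  have inv: "incl w a \<otimes>\<^bsub>P\<^esub> x \<in> D \<longleftrightarrow> x \<in> D"
    if "w = v \<or> {v, w} \<in> E" "a \<in> carrier (G w)" "x \<in> carrier P" for w a x
    using D that by (auto simp: star_invariant_def star_def)
  have h_closed: "h w a \<in> carrier K" if "w \<in> V" "a \<in> carrier (G w)" for w a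
    using that by (auto simp: h_def K_def)
  have hom: "h w \<in> hom (G w) K" if w: "w \<in> V" for w
  proof (rule homI)
    interpret Gw: group "G w" using grp w .
    show "h w (a \<otimes>\<^bsub>G w\<^esub> b) = h w a \<otimes>\<^bsub>K\<^esub> h w b"
      if "a \<in> carrier (G w)" "b \<in> carrier (G w)" for a b
      using that w by (auto simp: h_def K_def fun_eq_iff incl_mult inv)
  qed (use h_closed w in auto)
  have comm: "h u a \<otimes>\<^bsub>K\<^esub> h w b = h w b \<otimes>\<^bsub>K\<^esub> h u a"
    if uw: "{u, w} \<in> E" and ab: "a \<in> carrier (G u)" "b \<in> carrier (G w)" for u w a b
  proof -
    have "u \<in> V" "w \<in> V" "u \<noteq> w" "{w, u} \<in> E"
      using edge_in_V[OF uw] uw by (auto simp: insert_commute)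
    then show ?thesis
      using ab uw incl_commute[OF uw ab] by (auto simp: h_def K_def fun_eq_iff inv)
  qed
  obtain f where f: "group_hom P K f" "\<And>w a. w \<in> V \<Longrightarrow> a \<in> carrier (G w) \<Longrightarrow> f (incl w a) = h w a"
    using graph_product_universal[OF K hom comm] by blast
  interpret f: group_hom P K f by (rule f(1))
  \<comment> \<open>The second component is an endomorphism fixing all generators, hence the
    identity.\<close>
  have snd_hom: "group_hom P P (snd \<circ> f)"
  proof (intro group_hom.intro group_hom_axioms.intro P.is_group homI)
    show "(snd \<circ> f) x \<in> carrier P" if "x \<in> carrier P" for x
      using f.hom_closed[OF that] by (auto simp: K_def)
    show "(snd \<circ> f) (x \<otimes>\<^bsub>P\<^esub> y) = (snd \<circ> f) x \<otimes>\<^bsub>P\<^esub> (snd \<circ> f) y"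
      if "x \<in> carrier P" "y \<in> carrier P" for x y
      using f.hom_mult[OF that] by (auto simp: K_def split_beta)
  qed
  have snd_f: "snd (f x) = x" if "x \<in> carrier P" for x
  proof -
    have "group_hom P P (\<lambda>x. x)" by unfold_locales (auto simp: hom_def)
    from hom_eqI[OF snd_hom this _ that] show ?thesis by (simp add: f(2) h_def)
  qed
  have fst_f: "fst (f g) \<in> carrier P \<rightarrow>\<^sub>E carrier (G v)" if "g \<in> carrier P" for g
    using f.hom_closed[OF that] by (auto simp: K_def)
  have "cocycle v D (\<lambda>g. fst (f g))"
    unfolding cocycle_def
  proof (intro conjI ballI)
    show "fst (f g) x \<in> carrier (G v)" if "g \<in> carrier P" "x \<in> carrier P" for g x
      using fst_f[OF that(1)] that(2) by auto
    show "fst (f (g \<otimes>\<^bsub>P\<^esub> k)) x = fst (f g) (k \<otimes>\<^bsub>P\<^esub> x) \<otimes>\<^bsub>G v\<^esub> fst (f k) x"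
      if "g \<in> carrier P" "k \<in> carrier P" "x \<in> carrier P" for g k x
      using that snd_f[OF that(2)] f.hom_mult[OF that(1,2)]
      by (auto simp: K_def split_beta)
    show "fst (f (incl w a)) x = (if w = v \<and> x \<in> D then a else \<one>\<^bsub>G v\<^esub>)"
      if "w \<in> V" "a \<in> carrier (G w)" "x \<in> carrier P" for w a x
      using that by (simp add: f(2) h_def)
  qed
  then show ?thesis by blast
qed

lemma cocycleD:
  assumes "cocycle v D c"
  shows "g \<in> carrier P \<Longrightarrow> x \<in> carrier P \<Longrightarrow> c g x \<in> carrier (G v)"
    and "g \<in> carrier P \<Longrightarrow> h \<in> carrier P \<Longrightarrow> x \<in> carrier P \<Longrightarrow>
      c (g \<otimes>\<^bsub>P\<^esub> h) x = c g (h \<otimes>\<^bsub>P\<^esub> x) \<otimes>\<^bsub>G v\<^esub> c h x"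
    and "w \<in> V \<Longrightarrow> a \<in> carrier (G w) \<Longrightarrow> x \<in> carrier P \<Longrightarrow>
      c (incl w a) x = (if w = v \<and> x \<in> D then a else \<one>\<^bsub>G v\<^esub>)"
  using assms by (auto simp: cocycle_def)

lemma cocycle_one:
  assumes c: "cocycle v D c" and v: "v \<in> V" and x: "x \<in> carrier P"
  shows "c \<one>\<^bsub>P\<^esub> x = \<one>\<^bsub>G v\<^esub>"
proof -
  interpret Gv: group "G v" using grp v .
  have "c \<one>\<^bsub>P\<^esub> x \<otimes>\<^bsub>G v\<^esub> c \<one>\<^bsub>P\<^esub> x = c \<one>\<^bsub>P\<^esub> x"
    using cocycleD(2)[OF c, of "\<one>\<^bsub>P\<^esub>" "\<one>\<^bsub>P\<^esub>" x] x by simp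
  then show ?thesis using cocycleD(1)[OF c, of "\<one>\<^bsub>P\<^esub>" x] x by simp
qed

lemma cocycle_inv:
  assumes c: "cocycle v D c" and v: "v \<in> V" and x: "x \<in> carrier P" and g: "g \<in> carrier P"
  shows "c (inv\<^bsub>P\<^esub> g) x = inv\<^bsub>G v\<^esub> c g (inv\<^bsub>P\<^esub> g \<otimes>\<^bsub>P\<^esub> x)"
proof -
  interpret Gv: group "G v" using grp v .
  have "c g (inv\<^bsub>P\<^esub> g \<otimes>\<^bsub>P\<^esub> x) \<otimes>\<^bsub>G v\<^esub> c (inv\<^bsub>P\<^esub> g) x = \<one>\<^bsub>G v\<^esub>"
    using cocycleD(2)[OF c g, of "inv\<^bsub>P\<^esub> g" x] g x cocycle_one[OF c v x] by simp
  then show ?thesis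
    using cocycleD(1)[OF c] g x by (metis Gv.inv_equality Gv.inv_inv P.inv_closed P.m_closed Gv.inv_closed)
qed

text \<open>The value on a word depends only on which \<open>v\<close>-syllables are read inside the
  set. The lemma compares two starting points, two sets, or both.\<close>

lemma cocycle_cong:
  assumes c: "cocycle v D c" and c': "cocycle v D' c'" and v: "v \<in> V" and w: "w \<in> words V"
    and x: "x \<in> carrier P" and x': "x' \<in> carrier P"
    and DD': "\<And>A a B. w = A @ (v, a) # B \<Longrightarrow> val B \<otimes>\<^bsub>P\<^esub> x \<in> D \<longleftrightarrow> val B \<otimes>\<^bsub>P\<^esub> x' \<in> D'"
  shows "c (val w) x = c' (val w) x'"
  using w DD'
proof (induction w rule: list.induct)
  case Nil
  then show ?case using cocycle_one[OF c v x] cocycle_one[OF c' v x'] by simp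
next
  case (Cons p w)
  obtain u a where p: "p = (u, a)" by (cases p)
  have ua: "u \<in> V" "a \<in> carrier (G u)" and w: "w \<in> words V" using Cons.prems p by auto
  have "c (val w) x = c' (val w) x'"
  proof (rule Cons.IH[OF w])
    show "val B \<otimes>\<^bsub>P\<^esub> x \<in> D \<longleftrightarrow> val B \<otimes>\<^bsub>P\<^esub> x' \<in> D'" if "w = A @ (v, a') # B" for A a' B
      using Cons.prems(2)[of "p # A" a' B] that by simp
  qed
  moreover have "val w \<otimes>\<^bsub>P\<^esub> x \<in> D \<longleftrightarrow> val w \<otimes>\<^bsub>P\<^esub> x' \<in> D'" if "u = v"
    using Cons.prems(2)[of "[]" a w] p that by simp
  ultimately show ?case
    using ua w x x' by (auto simp: p cocycleD[OF c] cocycleD[OF c'])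
qed

lemma cocycle_trivial:
  assumes "v \<in> V"
  shows "cocycle v {} (\<lambda>_ _. \<one>\<^bsub>G v\<^esub>)"
proof -
  interpret Gv: group "G v" using grp assms .
  show ?thesis by (simp add: cocycle_def)
qed

text \<open>If \<open>D\<close> is a union of cosets of \<open>N\<close>, each \<open>c g\<close> is
  a function on the finite set of these cosets. Reducing its values modulo \<open>M\<close> gives a
  map to a finite wreath product of \<open>G v Mod M\<close> and \<open>P Mod N\<close>, and
  \<open>?L\<close> is the kernel of that map.\<close>

lemma fin_normal_cocycle:
  assumes c: "cocycle v D c" and v: "v \<in> V"
    and N: "fin_normal P N" and M: "fin_normal (G v) M"
    and D: "\<And>x n. x \<in> carrier P \<Longrightarrow> n \<in> N \<Longrightarrow> x \<otimes>\<^bsub>P\<^esub> n \<in> D \<longleftrightarrow> x \<in> D"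
  shows "fin_normal P {g \<in> N. \<forall>x \<in> carrier P. c g x \<in> M}" (is "fin_normal P ?L")
proof -
  interpret Gv: group "G v" using grp v .
  interpret N: normal N P by (rule fin_normalD(1)[OF N])
  interpret M: normal M "G v" by (rule fin_normalD(1)[OF M])
  note c_closed = cocycleD(1)[OF c] and c_mult = cocycleD(2)[OF c] and c_inv = cocycle_inv[OF c v]
  have right: "c g (x \<otimes>\<^bsub>P\<^esub> n) = c g x" if g: "g \<in> carrier P" and x: "x \<in> carrier P" and nN: "n \<in> N" for g x n
  proof -
    obtain w where w: "w \<in> words V" "g = val w" using ex_word[OF g] by blast
    have n: "n \<in> carrier P" using nN by simp
    show ?thesis
      unfolding w(2)
    proof (rule cocycle_cong[OF c c v w(1)])
      fix A a B assume "w = A @ (v, a) # B"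
      then have "val B \<in> carrier P" using w(1) by (intro val_closed[of V]) auto
      then show "val B \<otimes>\<^bsub>P\<^esub> (x \<otimes>\<^bsub>P\<^esub> n) \<in> D \<longleftrightarrow> val B \<otimes>\<^bsub>P\<^esub> x \<in> D"
        using D[of "val B \<otimes>\<^bsub>P\<^esub> x" n] x nN n by (simp add: P.m_assoc)
    qed (use x n in auto)
  qed
  \<comment> \<open>Normality of \<open>N\<close> turns a factor from \<open>N\<close> on the left
    of \<open>x\<close> into one on the right.\<close>
  have left: "c g (n \<otimes>\<^bsub>P\<^esub> x) = c g x" if "g \<in> carrier P" "x \<in> carrier P" "n \<in> N" for g x n
  proof -
    have n: "n \<in> carrier P" using that by simp
    have "inv\<^bsub>P\<^esub> x \<otimes>\<^bsub>P\<^esub> n \<otimes>\<^bsub>P\<^esub> x \<in> N" using that N.inv_op_closed1 by blast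
    from right[OF that(1,2) this] show ?thesis
      using that n by (simp add: P.m_assoc[symmetric])
  qed
  have sub: "subgroup ?L P"
  proof (rule P.subgroupI)
    show "?L \<subseteq> carrier P" using N.subset by blast
    have "\<one>\<^bsub>P\<^esub> \<in> ?L" using cocycle_one[OF c v] by simp
    then show "?L \<noteq> {}" by blast
    show "inv\<^bsub>P\<^esub> g \<in> ?L" if "g \<in> ?L" for g
      using that by (auto simp: c_inv)
    show "g \<otimes>\<^bsub>P\<^esub> h \<in> ?L" if "g \<in> ?L" "h \<in> ?L" for g h
      using that by (auto simp: c_mult)
  qed
  moreover have "?L \<lhd> P"
  proof (rule P.normal_invI[OF sub])
    fix k g assume k: "k \<in> carrier P" and g: "g \<in> ?L"
    have "c (k \<otimes>\<^bsub>P\<^esub> g \<otimes>\<^bsub>P\<^esub> inv\<^bsub>P\<^esub> k) x \<in> M" if x: "x \<in> carrier P" for x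
    proof -
      let ?y = "inv\<^bsub>P\<^esub> k \<otimes>\<^bsub>P\<^esub> x"
      have y: "?y \<in> carrier P" and gP: "g \<in> carrier P" using k x g by auto
      have "c (k \<otimes>\<^bsub>P\<^esub> g \<otimes>\<^bsub>P\<^esub> inv\<^bsub>P\<^esub> k) x
          = c k (g \<otimes>\<^bsub>P\<^esub> ?y) \<otimes>\<^bsub>G v\<^esub> c g ?y \<otimes>\<^bsub>G v\<^esub> c (inv\<^bsub>P\<^esub> k) x"
        using k x gP y by (simp add: c_mult)
      \<comment> \<open>As \<open>g\<close> lies in \<open>N\<close>, the point \<open>g ?y\<close>
        may be replaced by \<open>?y\<close>, which makes the value a conjugate of
        \<open>c g ?y\<close>.\<close>
      also have "\<dots> = c k ?y \<otimes>\<^bsub>G v\<^esub> c g ?y \<otimes>\<^bsub>G v\<^esub> inv\<^bsub>G v\<^esub> c k ?y"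
        using k x g y left[of k ?y g] by (simp add: c_inv)
      also have "\<dots> \<in> M"
        using g y k c_closed by (intro M.inv_op_closed2) auto
      finally show ?thesis .
    qed
    then show "k \<otimes>\<^bsub>P\<^esub> g \<otimes>\<^bsub>P\<^esub> inv\<^bsub>P\<^esub> k \<in> ?L"
      using k g N.inv_op_closed2 by auto
  qed
  \<comment> \<open>\<open>d\<close> records the coset of \<open>g\<close> modulo \<open>N\<close>
    together with the table of values of \<open>c g\<close> modulo \<open>M\<close>, evaluated at
    one representative of each coset of \<open>N\<close>.\<close>
  moreover have "finite_index P ?L"
  proof (rule P.finite_indexI[OF sub, where
      B = "(rcosets\<^bsub>P\<^esub> N) \<times> ((rcosets\<^bsub>P\<^esub> N) \<rightarrow>\<^sub>E (rcosets\<^bsub>G v\<^esub> M))" and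
      d = "\<lambda>g. (N #>\<^bsub>P\<^esub> g, \<lambda>C\<in>rcosets\<^bsub>P\<^esub> N. M #>\<^bsub>G v\<^esub> c g (SOME x. x \<in> C))"])
    show "finite ((rcosets\<^bsub>P\<^esub> N) \<times> ((rcosets\<^bsub>P\<^esub> N) \<rightarrow>\<^sub>E (rcosets\<^bsub>G v\<^esub> M)))"
      using fin_normalD(3)[OF N] fin_normalD(3)[OF M]
      by (intro finite_cartesian_product finite_PiE) (auto simp: finite_index_def)
    have some: "\<exists>n\<in>N. (SOME x. x \<in> N #>\<^bsub>P\<^esub> y) = n \<otimes>\<^bsub>P\<^esub> y" if "y \<in> carrier P" for y
    proof -
      have "(SOME x. x \<in> N #>\<^bsub>P\<^esub> y) \<in> N #>\<^bsub>P\<^esub> y"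
        by (rule someI) (rule P.rcos_self[OF that N.is_subgroup])
      then show ?thesis by (auto simp: r_coset_def)
    qed
    show "(N #>\<^bsub>P\<^esub> g, \<lambda>C\<in>rcosets\<^bsub>P\<^esub> N. M #>\<^bsub>G v\<^esub> c g (SOME x. x \<in> C))
        \<in> (rcosets\<^bsub>P\<^esub> N) \<times> ((rcosets\<^bsub>P\<^esub> N) \<rightarrow>\<^sub>E (rcosets\<^bsub>G v\<^esub> M))" if g: "g \<in> carrier P" for g
    proof -
      have "M #>\<^bsub>G v\<^esub> c g (SOME x. x \<in> C) \<in> rcosets\<^bsub>G v\<^esub> M" if "C \<in> rcosets\<^bsub>P\<^esub> N" for C
      proof -
        obtain y where y: "y \<in> carrier P" "C = N #>\<^bsub>P\<^esub> y" using \<open>C \<in> _\<close> by (auto simp: RCOSETS_def)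
        obtain n where "n \<in> N" "(SOME x. x \<in> C) = n \<otimes>\<^bsub>P\<^esub> y" using some[OF y(1)] y(2) by blast
        then show ?thesis
          using g y c_closed by (intro Gv.rcosetsI M.subset) auto
      qed
      then show ?thesis using g N.subset by (auto intro: P.rcosetsI)
    qed
    fix g h assume g: "g \<in> carrier P" and h: "h \<in> carrier P"
      and eq: "(N #>\<^bsub>P\<^esub> g, \<lambda>C\<in>rcosets\<^bsub>P\<^esub> N. M #>\<^bsub>G v\<^esub> c g (SOME x. x \<in> C))
        = (N #>\<^bsub>P\<^esub> h, \<lambda>C\<in>rcosets\<^bsub>P\<^esub> N. M #>\<^bsub>G v\<^esub> c h (SOME x. x \<in> C))"
    have "c (g \<otimes>\<^bsub>P\<^esub> inv\<^bsub>P\<^esub> h) x \<in> M" if x: "x \<in> carrier P" for x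
    proof -
      \<comment> \<open>By the cocycle law the value of \<open>c\<close> on \<open>g\<close> times
        the inverse of \<open>h\<close>, at \<open>x\<close>, is the quotient of \<open>c g\<close>
        and \<open>c h\<close> at this shifted point.\<close>
      let ?y = "inv\<^bsub>P\<^esub> h \<otimes>\<^bsub>P\<^esub> x"
      have y: "?y \<in> carrier P" using h x by simp
      obtain n where n: "n \<in> N" "(SOME x. x \<in> N #>\<^bsub>P\<^esub> ?y) = n \<otimes>\<^bsub>P\<^esub> ?y"
        using some[OF y] by blast
      have "N #>\<^bsub>P\<^esub> ?y \<in> rcosets\<^bsub>P\<^esub> N" using y N.subset by (intro P.rcosetsI)
      with fun_cong[OF conjunct2[OF iffD1[OF prod.inject eq]], of "N #>\<^bsub>P\<^esub> ?y"] have "M #>\<^bsub>G v\<^esub> c g (SOME x. x \<in> N #>\<^bsub>P\<^esub> ?y) = M #>\<^bsub>G v\<^esub> c h (SOME x. x \<in> N #>\<^bsub>P\<^esub> ?y)"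
        by (simp only: restrict_apply')
      then have "M #>\<^bsub>G v\<^esub> c g ?y = M #>\<^bsub>G v\<^esub> c h ?y"
        using left[OF g y n(1)] left[OF h y n(1)] n(2) by simp
      then have "c g ?y \<otimes>\<^bsub>G v\<^esub> inv\<^bsub>G v\<^esub> c h ?y \<in> M"
        using g h y c_closed by (simp add: Gv.r_coset_eq_iff[OF M.is_subgroup])
      then show ?thesis using g h x by (simp add: c_mult c_inv)
    qed
    moreover have "g \<otimes>\<^bsub>P\<^esub> inv\<^bsub>P\<^esub> h \<in> N"
      using eq g h by (simp add: P.r_coset_eq_iff[OF N.is_subgroup])
    ultimately show "g \<otimes>\<^bsub>P\<^esub> inv\<^bsub>P\<^esub> h \<in> ?L" by simp
  qed
  ultimately show ?thesis by (simp add: fin_normal_def)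
qed

end

section \<open>Reduced words and residual finiteness\<close>

lemma (in group) inv_mult_cancel:
  assumes "x \<in> carrier G" "y \<in> carrier G"
  shows "inv x \<otimes> (x \<otimes> y) = y" "x \<otimes> (inv x \<otimes> y) = y"
  using assms by (simp_all add: m_assoc[symmetric])

lemma (in group) subgroup_mult_left_iff:
  assumes "subgroup L G" "s \<in> L" "y \<in> carrier G"
  shows "s \<otimes> y \<in> L \<longleftrightarrow> y \<in> L"
proof
  interpret L: subgroup L G by fact
  assume "s \<otimes> y \<in> L"
  then have "inv s \<otimes> (s \<otimes> y) \<in> L" using assms(2) by blast
  then show "y \<in> L" using assms(2,3) L.mem_carrier by (simp add: m_assoc[symmetric])
qed (rule subgroup.m_closed[OF assms(1,2)])

lemma (in group) subgroup_mult_right_iff: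
  assumes "subgroup L G" "s \<in> L" "y \<in> carrier G"
  shows "y \<otimes> s \<in> L \<longleftrightarrow> y \<in> L"
proof
  interpret L: subgroup L G by fact
  assume "y \<otimes> s \<in> L"
  then have "(y \<otimes> s) \<otimes> inv s \<in> L" using assms(2) by blast
  then show "y \<in> L" using assms(2,3) L.mem_carrier by (simp add: m_assoc)
qed (use subgroup.m_closed[OF assms(1) _ assms(2)] in blast)

section \<open>Full subgroups seen in finite quotients\<close>

context vertex_groups
begin

text \<open>This is the preimage of the image of \<langle>S\<rangle> in \<open>P Mod N\<close>.
  Lying in \<open>msub N S\<close> for all \<open>N\<close> of finite index means lying in the
  closure of \<langle>S\<rangle> in the profinite topology.\<close>

definition msub :: "('v \<times> 'a) list set set set \<Rightarrow> 'v set \<Rightarrow> ('v \<times> 'a) list set set set" where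
  "msub N S = N <#>\<^bsub>P\<^esub> sub S"

lemma msub_iff: "x \<in> msub N S \<longleftrightarrow> (\<exists>n\<in>N. \<exists>h\<in>sub S. x = n \<otimes>\<^bsub>P\<^esub> h)"
  by (auto simp: msub_def set_mult_def)

lemma msub_mono: "M \<subseteq> N \<Longrightarrow> x \<in> msub M S \<Longrightarrow> x \<in> msub N S"
  by (auto simp: msub_iff)

lemma msub_subgroup:
  assumes "fin_normal P N" "S \<subseteq> V"
  shows "subgroup (msub N S) P"
  unfolding msub_def by (rule P.mult_norm_subgroup[OF fin_normalD(1)[OF assms(1)] sub_subgroup[OF assms(2)]])

lemma subset_msub:
  assumes N: "fin_normal P N" and S: "S \<subseteq> V"
  shows "N \<subseteq> msub N S" "sub S \<subseteq> msub N S"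
proof -
  interpret N: subgroup N P by (rule fin_normalD(2)[OF N])
  interpret S: subgroup "sub S" P by (rule sub_subgroup[OF S])
  show "N \<subseteq> msub N S"
  proof
    fix x assume "x \<in> N"
    then show "x \<in> msub N S"
      unfolding msub_iff by (intro bexI[of _ x] bexI[of _ "\<one>\<^bsub>P\<^esub>"]) auto
  qed
  show "sub S \<subseteq> msub N S"
  proof
    fix x assume "x \<in> sub S"
    then show "x \<in> msub N S"
      unfolding msub_iff by (intro bexI[of _ "\<one>\<^bsub>P\<^esub>"] bexI[of _ x]) auto
  qed
qed

text \<open>A single finite quotient decides, for finitely many elements at once, which of them lie
  in the closure of \<langle>S\<rangle>: intersect one excluding \<open>N\<close> for each element
  outside the closure.\<close>

lemma ex_level:
  assumes "finite Z"
  shows "\<exists>N. fin_normal P N \<and> (\<forall>z\<in>Z. z \<in> msub N S \<longrightarrow> (\<forall>N'. fin_normal P N' \<longrightarrow> z \<in> msub N' S))"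
proof -
  \<comment> \<open>For an element of the closure any \<open>N\<close> will do, and
    \<open>carrier P\<close> is taken.\<close>
  have "\<exists>N. fin_normal P N \<and> (z \<in> msub N S \<longrightarrow> (\<forall>N'. fin_normal P N' \<longrightarrow> z \<in> msub N' S))" for z
    using P.fin_normal_carrier by blast
  then obtain f where f: "\<And>z. fin_normal P (f z)"
    "\<And>z N'. z \<in> msub (f z) S \<Longrightarrow> fin_normal P N' \<Longrightarrow> z \<in> msub N' S"
    by metis
  let ?N = "carrier P \<inter> (\<Inter>z\<in>Z. f z)"
  have "fin_normal P ?N" by (rule P.fin_normal_INT[OF assms f(1)])
  moreover have "z \<in> msub N' S" if z: "z \<in> Z" "z \<in> msub ?N S" and N': "fin_normal P N'" for z N'
  proof (rule f(2)[OF _ N'])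
    show "z \<in> msub (f z) S" by (rule msub_mono[OF _ z(2)]) (use z(1) in blast)
  qed
  ultimately show ?thesis by blast
qed

text \<open>The set is the coset through \<open>b\<close> of a subgroup that contains \<langle>star
  v\<rangle>, so left multiplication by letters of the star preserves it.\<close>

lemma star_invariant_coset:
  assumes v: "v \<in> V" and N: "fin_normal P N" and b: "b \<in> carrier P"
  shows "star_invariant v {x \<in> carrier P. x \<otimes>\<^bsub>P\<^esub> inv\<^bsub>P\<^esub> b \<in> msub N (star v)}"
  unfolding star_invariant_def
proof (intro ballI)
  fix w a x assume w: "w \<in> star v" and a: "a \<in> carrier (G w)" and x: "x \<in> carrier P"
  note L = msub_subgroup[OF N star_subset[OF v]]
  have "incl w a \<in> msub N (star v)"
    using subset_msub(2)[OF N star_subset[OF v]] incl_in_sub[OF star_subset[OF v] w a] by blast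
  then show "incl w a \<otimes>\<^bsub>P\<^esub> x \<in> {x \<in> carrier P. x \<otimes>\<^bsub>P\<^esub> inv\<^bsub>P\<^esub> b \<in> msub N (star v)}
      \<longleftrightarrow> x \<in> {x \<in> carrier P. x \<otimes>\<^bsub>P\<^esub> inv\<^bsub>P\<^esub> b \<in> msub N (star v)}"
    using P.subgroup_mult_left_iff[OF L, of "incl w a" "x \<otimes>\<^bsub>P\<^esub> inv\<^bsub>P\<^esub> b"] x b subgroup.mem_carrier[OF L]
    by (simp add: P.m_assoc)
qed

text \<open>The subgroup contains the normal subgroup \<open>N\<close>, so its coset is a union of
  cosets of \<open>N\<close>. This supplies the invariance required in
  \<open>fin_normal_cocycle\<close>.\<close>

lemma coset_right_invariant:
  assumes v: "v \<in> V" and N: "fin_normal P N" and b: "b \<in> carrier P"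
    and x: "x \<in> carrier P" and n: "n \<in> N"
  shows "x \<otimes>\<^bsub>P\<^esub> n \<in> {x \<in> carrier P. x \<otimes>\<^bsub>P\<^esub> inv\<^bsub>P\<^esub> b \<in> msub N (star v)}
      \<longleftrightarrow> x \<in> {x \<in> carrier P. x \<otimes>\<^bsub>P\<^esub> inv\<^bsub>P\<^esub> b \<in> msub N (star v)}"
proof -
  interpret N: normal N P by (rule fin_normalD(1)[OF N])
  note L = msub_subgroup[OF N star_subset[OF v]]
  have nP: "n \<in> carrier P" using n by (rule N.mem_carrier)
  have "x \<otimes>\<^bsub>P\<^esub> n \<otimes>\<^bsub>P\<^esub> inv\<^bsub>P\<^esub> x \<in> msub N (star v)"
    using subset_msub(1)[OF N star_subset[OF v]] N.inv_op_closed2[OF x n] by blast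
  moreover have "x \<otimes>\<^bsub>P\<^esub> n \<otimes>\<^bsub>P\<^esub> inv\<^bsub>P\<^esub> b = (x \<otimes>\<^bsub>P\<^esub> n \<otimes>\<^bsub>P\<^esub> inv\<^bsub>P\<^esub> x) \<otimes>\<^bsub>P\<^esub> (x \<otimes>\<^bsub>P\<^esub> inv\<^bsub>P\<^esub> b)"
    using x nP b by (simp add: P.inv_mult_cancel P.m_assoc)
  ultimately show ?thesis
    using P.subgroup_mult_left_iff[OF L, of "x \<otimes>\<^bsub>P\<^esub> n \<otimes>\<^bsub>P\<^esub> inv\<^bsub>P\<^esub> x" "x \<otimes>\<^bsub>P\<^esub> inv\<^bsub>P\<^esub> b"] x nP b
    by simp
qed

text \<open>If no \<open>v\<close>-syllable were read inside \<open>D\<close>, the cocycle would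
  agree on \<open>w\<close> with the trivial one for the empty set.\<close>

lemma cocycle_active:
  assumes c: "cocycle v D c" and v: "v \<in> V" and w: "w \<in> words V" and x: "x \<in> carrier P"
    and ne: "c (val w) x \<noteq> \<one>\<^bsub>G v\<^esub>"
  shows "\<exists>A a B. w = A @ (v, a) # B \<and> val B \<otimes>\<^bsub>P\<^esub> x \<in> D"
proof (rule ccontr)
  assume "\<not> ?thesis"
  then have "c (val w) x = \<one>\<^bsub>G v\<^esub>"
    by (intro cocycle_cong[OF c cocycle_trivial[OF v] v w x x]) auto
  then show False using ne by simp
qed

text \<open>Minimal length over all words for the same element replaces the usual condition on
  shuffling syllables; existence is then immediate.\<close>

definition reduced :: "('v \<times> 'a) list \<Rightarrow> bool" where
  "reduced w \<longleftrightarrow> w \<in> words V \<and> (\<forall>w' \<in> words V. val w' = val w \<longrightarrow> length w \<le> length w')"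

lemma reducedD:
  "reduced w \<Longrightarrow> w \<in> words V"
  "reduced w \<Longrightarrow> w' \<in> words V \<Longrightarrow> val w' = val w \<Longrightarrow> length w \<le> length w'"
  by (auto simp: reduced_def)

lemma ex_reduced:
  assumes "x \<in> carrier P"
  shows "\<exists>w. reduced w \<and> val w = x"
proof -
  obtain w0 where "w0 \<in> words V \<and> x = val w0" using ex_word[OF assms] by blast
  then obtain w where "w \<in> words V \<and> x = val w"
    "\<forall>w'. w' \<in> words V \<and> x = val w' \<longrightarrow> length w \<le> length w'"
    using ex_has_least_nat[of "\<lambda>w. w \<in> words V \<and> x = val w" w0 length] by blast
  then show ?thesis by (intro exI[of _ w]) (auto simp: reduced_def)
qed

lemma val_append_V: "x \<in> words V \<Longrightarrow> y \<in> words V \<Longrightarrow> val (x @ y) = val x \<otimes>\<^bsub>P\<^esub> val y"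
  by (rule val_append[OF order_refl])

lemma reduced_infix:
  assumes r: "reduced (A @ B @ C)"
  shows "reduced B"
proof -
  have w: "A \<in> words V" "B \<in> words V" "C \<in> words V" using reducedD(1)[OF r] by auto
  have "length B \<le> length B'" if B': "B' \<in> words V" "val B' = val B" for B'
    using reducedD(2)[OF r, of "A @ B' @ C"] w B' by (simp add: val_append_V)
  then show ?thesis using w by (simp add: reduced_def)
qed

text \<open>All letters of the star commute with \<open>G v\<close>, so the
  \<open>v\<close>-syllables can be collected in front into one element \<open>d\<close>. The bound
  counts only the remaining syllables.\<close>

lemma star_word:
  assumes v: "v \<in> V" and m: "m \<in> words (star v)"
  shows "\<exists>d \<in> carrier (G v). \<exists>m' \<in> words V. val m = incl v d \<otimes>\<^bsub>P\<^esub> val m' \<and>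
    length m' \<le> length (filter (\<lambda>p. fst p \<noteq> v) m)"
  using m
proof (induction m rule: list.induct)
  case Nil
  interpret Gv: group "G v" using grp v .
  show ?case
    by (intro bexI[of _ "\<one>\<^bsub>G v\<^esub>"] bexI[of _ "[]"]) (auto simp: incl_one v)
next
  case (Cons p m)
  interpret Gv: group "G v" using grp v .
  obtain u a where p: "p = (u, a)" by (cases p)
  have ua: "u \<in> star v" "a \<in> carrier (G u)" and m: "m \<in> words (star v)" using Cons.prems p by auto
  obtain d m' where dm: "d \<in> carrier (G v)" "m' \<in> words V" "val m = incl v d \<otimes>\<^bsub>P\<^esub> val m'"
    "length m' \<le> length (filter (\<lambda>p. fst p \<noteq> v) m)"
    using Cons.IH[OF m] by blast
  have c: "incl v d \<in> carrier P" "val m' \<in> carrier P" using dm v by simp_all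
  show ?case
  proof (cases "u = v")
    case True
    then have a: "a \<in> carrier (G v)" using ua by simp
    have "val (p # m) = incl v (a \<otimes>\<^bsub>G v\<^esub> d) \<otimes>\<^bsub>P\<^esub> val m'"
      using True a dm c v by (simp add: p incl_mult P.m_assoc)
    then show ?thesis
      using a dm True by (intro bexI[of _ "a \<otimes>\<^bsub>G v\<^esub> d"] bexI[of _ m']) (auto simp: p)
  next
    case False
    then have e: "{v, u} \<in> E" and u: "u \<in> V" using ua star_subset[OF v] by (auto simp: star_def)
    have iu: "incl u a \<in> carrier P" using u ua by simp
    have "val (p # m) = (incl u a \<otimes>\<^bsub>P\<^esub> incl v d) \<otimes>\<^bsub>P\<^esub> val m'"
      using iu c by (simp add: p dm(3) P.m_assoc)
    also have "\<dots> = incl v d \<otimes>\<^bsub>P\<^esub> val ((u, a) # m')"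
      using iu c incl_commute[OF e dm(1) ua(2)] by (simp add: P.m_assoc[symmetric])
    finally show ?thesis
      using dm ua u False by (intro bexI[of _ d] bexI[of _ "(u, a) # m'"]) (auto simp: p)
  qed
qed

text \<open>The two outer syllables merge across \<open>m\<close>: the infix of length
  \<open>length m + 2\<close> equals one \<open>v\<close>-syllable followed by at most
  \<open>length m\<close> others.\<close>

lemma not_reduced_star:
  assumes v: "v \<in> V" and m: "m \<in> words (star v)" and a: "a \<in> carrier (G v)" and b: "b \<in> carrier (G v)"
  shows "\<not> reduced (A @ ((v, a) # m @ [(v, b)]) @ B)"
proof
  assume "reduced (A @ ((v, a) # m @ [(v, b)]) @ B)"
  then have r: "reduced ((v, a) # m @ [(v, b)])" by (rule reduced_infix)
  have "(v, a) # m @ [(v, b)] \<in> words (star v)" using m a b by (simp add: star_def)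
  from star_word[OF v this] obtain d m' where d: "d \<in> carrier (G v)" "m' \<in> words V"
    "val ((v, a) # m @ [(v, b)]) = val ((v, d) # m')" "length m' \<le> length (filter (\<lambda>p. fst p \<noteq> v) m)"
    by auto
  have "length ((v, a) # m @ [(v, b)]) \<le> length ((v, d) # m')"
    by (rule reducedD(2)[OF r _ d(3)[symmetric]]) (use v d in simp)
  then show False using d(4) length_filter_le[of "\<lambda>p. fst p \<noteq> v" m] by simp
qed

lemma finite_infixes: "finite {m. \<exists>A C. w = A @ m @ C}"
proof (rule finite_subset)
  show "{m. \<exists>A C. w = A @ m @ C} \<subseteq> (\<lambda>(i, j). take j (drop i w)) ` ({..length w} \<times> {..length w})"
  proof
    fix m assume "m \<in> {m. \<exists>A C. w = A @ m @ C}"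
    then obtain A C where w: "w = A @ m @ C" by blast
    then show "m \<in> (\<lambda>(i, j). take j (drop i w)) ` ({..length w} \<times> {..length w})"
      by (intro image_eqI[of _ _ "(length A, length m)"]) auto
  qed
qed auto

text \<open>A syllable outside \<open>S\<close> would be the only one of its type detected by a suitable cocycle,
  unless the word can be shortened.\<close>

lemma reduced_closure:
  assumes rf: "\<And>v. v \<in> V \<Longrightarrow> residually_finite (G v)"
    and "reduced w" "S \<subseteq> V" "\<And>N. fin_normal P N \<Longrightarrow> val w \<in> msub N S"
  shows "w \<in> words S"
  using assms(2-4)
\<comment> \<open>\<open>S\<close> is generalised because the induction hypothesis is applied to
  infixes of \<open>w\<close> with \<open>star v\<close> in place of \<open>S\<close>.\<close>
proof (induction w arbitrary: S rule: measure_induct_rule[of length])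
  case (less w)
  note r = less.prems(1) and S = less.prems(2) and cl = less.prems(3)
  have wV: "w \<in> words V" using reducedD(1)[OF r] .
  show ?case
  proof (rule ccontr)
    assume "w \<notin> words S"
    then obtain v e where "(v, e) \<in> set w" and vS: "v \<notin> S"
      using wV by (auto simp: words_def)
    then obtain A B where w: "w = A @ (v, e) # B" by (meson split_list)
    have AB: "A \<in> words V" "B \<in> words V" and v: "v \<in> V" and e: "e \<in> carrier (G v)"
      using wV w by auto
    interpret Gv: group "G v" using grp v .
    have cP: "val A \<in> carrier P" "val B \<in> carrier P" "incl v e \<in> carrier P" using AB v e by simp_all
    note starV = star_subset[OF v]
    have "e \<noteq> \<one>\<^bsub>G v\<^esub>"
    proof
      assume "e = \<one>\<^bsub>G v\<^esub>"
      then have "val (A @ B) = val w" using AB v e cP by (simp add: w val_append_V incl_one)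
      from reducedD(2)[OF r _ this] AB w show False by simp
    qed
    then obtain M where M: "fin_normal (G v) M" "e \<notin> M"
      using rf[OF v] e by (auto simp: residually_finite_alt)
    \<comment> \<open>\<open>N\<close> is taken fine enough that every infix of \<open>w\<close>
      lying in \<open>msub N (star v)\<close> lies in the closure of \<langle>star v\<rangle>, as
      the induction hypothesis demands.\<close>
    have "finite (val ` {m. \<exists>A C. w = A @ m @ C})" using finite_infixes by blast
    from ex_level[OF this, of "star v"] obtain N where N: "fin_normal P N"
      and level: "\<And>m A C N'. w = A @ m @ C \<Longrightarrow> val m \<in> msub N (star v) \<Longrightarrow> fin_normal P N' \<Longrightarrow>
        val m \<in> msub N' (star v)"
      by blast
    let ?L = "msub N (star v)"
    note L = msub_subgroup[OF N starV]
    have incl_L: "incl v a \<in> ?L" if "a \<in> carrier (G v)" for a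
      using subset_msub(2)[OF N starV] incl_in_sub[OF starV _ that] by (auto simp: star_def)
    \<comment> \<open>An infix \<open>m\<close> between two \<open>v\<close>-syllables with value in
      \<open>?L\<close> is, by induction, spelled in the star, so the two syllables could be
      merged.\<close>
    have shorten: False
      if split: "w = A' @ ((v, a) # m @ [(v, b)]) @ B'" and mL: "val m \<in> ?L" for A' a m b B'
    proof -
      have mid: "w = (A' @ [(v, a)]) @ m @ ((v, b) # B')" using split by simp
      have "reduced m" using r reduced_infix[of "A' @ [(v, a)]" m "(v, b) # B'"] mid by simp
      moreover have "length m < length w" using split by simp
      ultimately have "m \<in> words (star v)"
        using less.IH starV level[OF mid mL] by blast
      moreover have "a \<in> carrier (G v)" "b \<in> carrier (G v)" using wV split by auto
      ultimately show False using not_reduced_star[OF v] r split by blast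
    qed
    \<comment> \<open>\<open>D\<close> is the coset of \<open>?L\<close> through
      \<open>val B\<close>, so reading \<open>w\<close> from the identity meets the syllable
      \<open>e\<close> inside \<open>D\<close>. The claims \<open>B1\<close> and \<open>A1\<close>
      show that no other syllable contributes.\<close>
    define D where "D = {x \<in> carrier P. x \<otimes>\<^bsub>P\<^esub> inv\<^bsub>P\<^esub> val B \<in> ?L}"
    obtain c where c: "cocycle v D c"
      using ex_cocycle[OF v] star_invariant_coset[OF v N cP(2)] unfolding D_def by blast
    note c_mult = cocycleD(2)[OF c]
    let ?K = "{g \<in> N. \<forall>x \<in> carrier P. c g x \<in> M}"
    have K: "fin_normal P ?K"
    proof (rule fin_normal_cocycle[OF c v N M(1)])
      show "x \<otimes>\<^bsub>P\<^esub> n \<in> D \<longleftrightarrow> x \<in> D" if "x \<in> carrier P" "n \<in> N" for x n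
        unfolding D_def by (rule coset_right_invariant[OF v N cP(2) that])
    qed
    obtain n h where n: "n \<in> ?K" and h: "h \<in> sub S" and nh: "val w = n \<otimes>\<^bsub>P\<^esub> h"
      using cl[OF K] by (auto simp: msub_iff)
    obtain w' where w': "w' \<in> words S" "h = val w'" using h by (auto simp: sub_def)
    have w'V: "w' \<in> words V" using words_mono[OF S w'(1)] .
    have hP: "h \<in> carrier P" using w'V w'(2) by simp
    have nP: "n \<in> carrier P" using subgroup.mem_carrier[OF fin_normalD(2)[OF N]] n by blast
    \<comment> \<open>\<open>h\<close> has a spelling without \<open>v\<close>-syllables. The factor
      \<open>n\<close> contributes only an element of \<open>M\<close>, so the value on
      \<open>w\<close> lies in \<open>M\<close>, although it will turn out to be
      \<open>e\<close>.\<close>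
    have "c h \<one>\<^bsub>P\<^esub> = \<one>\<^bsub>G v\<^esub>"
    proof (rule ccontr)
      assume "c h \<one>\<^bsub>P\<^esub> \<noteq> \<one>\<^bsub>G v\<^esub>"
      then obtain A a B where "w' = A @ (v, a) # B"
        using cocycle_active[OF c v w'V, of "\<one>\<^bsub>P\<^esub>"] w'(2) by auto
      then show False using w'(1) vS by simp
    qed
    then have cw: "c (val w) \<one>\<^bsub>P\<^esub> \<in> M"
      using n hP nP subgroup.mem_carrier[OF fin_normalD(2)[OF M(1)]] by (simp add: nh c_mult)
    have L_one: "\<one>\<^bsub>P\<^esub> \<in> ?L" by (rule subgroup.one_closed[OF L])
    have B1: "c (val B) \<one>\<^bsub>P\<^esub> = \<one>\<^bsub>G v\<^esub>"
    proof (rule ccontr)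
      assume "c (val B) \<one>\<^bsub>P\<^esub> \<noteq> \<one>\<^bsub>G v\<^esub>"
      then obtain m a B' where B: "B = m @ (v, a) # B'" and D: "val B' \<otimes>\<^bsub>P\<^esub> \<one>\<^bsub>P\<^esub> \<in> D"
        using cocycle_active[OF c v AB(2)] by blast
      have m: "m \<in> words V" "a \<in> carrier (G v)" "B' \<in> words V" using AB B by auto
      let ?k = "val m \<otimes>\<^bsub>P\<^esub> incl v a"
      have k: "?k \<in> carrier P" using m v by simp
      have "val B = ?k \<otimes>\<^bsub>P\<^esub> val B'" using m v by (simp add: B val_append_V P.m_assoc)
      then have "val B' \<otimes>\<^bsub>P\<^esub> inv\<^bsub>P\<^esub> val B = inv\<^bsub>P\<^esub> ?k"
        using m k by (simp add: P.inv_mult_group P.m_assoc[symmetric])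
      then have "inv\<^bsub>P\<^esub> ?k \<in> ?L" using D m by (simp add: D_def)
      then have "?k \<in> ?L" using subgroup.m_inv_closed[OF L] k by fastforce
      then have "val m \<in> ?L"
        using P.subgroup_mult_right_iff[OF L incl_L[OF m(2)]] m by simp
      then show False using shorten[of A e m a B'] w B by simp
    qed
    have A1: "c (val A) (incl v e \<otimes>\<^bsub>P\<^esub> val B) = \<one>\<^bsub>G v\<^esub>"
    proof (rule ccontr)
      assume "c (val A) (incl v e \<otimes>\<^bsub>P\<^esub> val B) \<noteq> \<one>\<^bsub>G v\<^esub>"
      then obtain A' a m where A: "A = A' @ (v, a) # m"
        and D: "val m \<otimes>\<^bsub>P\<^esub> (incl v e \<otimes>\<^bsub>P\<^esub> val B) \<in> D"
        using cocycle_active[OF c v AB(1), of "incl v e \<otimes>\<^bsub>P\<^esub> val B"] cP by auto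
      have m: "m \<in> words V" using AB A by auto
      have "val m \<otimes>\<^bsub>P\<^esub> incl v e \<in> ?L" using D cP m by (simp add: D_def P.m_assoc)
      then have "val m \<in> ?L"
        using P.subgroup_mult_right_iff[OF L incl_L[OF e]] m by simp
      then show False using shorten[of A' a m e B] w A by simp
    qed
    have "val B \<in> D" using cP L_one by (simp add: D_def)
    then have "c (val w) \<one>\<^bsub>P\<^esub> = e"
      using A1 B1 AB v e cP by (simp add: w val_append_V c_mult cocycleD(3)[OF c])
    then show False using cw M(2) by simp
  qed
qed

text \<open>An element of every \<open>N\<close> lies in the closure of the trivial subgroup
  \<langle>{}\<rangle>, so a reduced word for it has no letters.\<close>

lemma residually_finite_P:
  assumes rf: "\<And>v. v \<in> V \<Longrightarrow> residually_finite (G v)"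
    and x: "x \<in> carrier P" and N: "\<And>N. fin_normal P N \<Longrightarrow> x \<in> N"
  shows "x = \<one>\<^bsub>P\<^esub>"
proof -
  obtain w where w: "reduced w" "val w = x" using ex_reduced[OF x] by blast
  have "w \<in> words {}"
    by (rule reduced_closure[OF rf w(1)]) (use subset_msub(1) N w(2) in auto)
  then have "w = []" by (cases w) (auto simp: words_def)
  then show ?thesis using w by simp
qed

section \<open>Conjugation into stars\<close>

text \<open>Compare the two cocycles that multiply up the \<open>v\<close>-syllables read outside \<open>L\<close>, the closure
  of the star of \<open>v\<close>, and all \<open>v\<close>-syllables, respectively.  The first is trivial on \<open>incl v a\<close>, the
  second is not; hence the word \<open>B\<close> has to pass through \<open>L\<close>.\<close>

lemma conjugator_suffix:
  assumes v: "v \<in> V" and rf: "residually_finite (G v)"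
    and a: "a \<in> carrier (G v)" "a \<noteq> \<one>\<^bsub>G v\<^esub>"
    and B: "B \<in> words V" and N: "fin_normal P N"
  shows "\<exists>N'. fin_normal P N' \<and> (\<forall>g \<in> carrier P.
    (val B \<otimes>\<^bsub>P\<^esub> g) \<otimes>\<^bsub>P\<^esub> inv\<^bsub>P\<^esub> (g \<otimes>\<^bsub>P\<^esub> incl v a) \<in> N' \<longrightarrow>
    (\<exists>A C. B = A @ C \<and> val C \<otimes>\<^bsub>P\<^esub> g \<in> msub N (star v)))"
proof -
  interpret Gv: group "G v" using grp v .
  obtain M where M: "fin_normal (G v) M" "a \<notin> M"
    using rf a by (auto simp: residually_finite_alt)
  interpret M: normal M "G v" by (rule fin_normalD(1)[OF M(1)])
  interpret N: normal N P by (rule fin_normalD(1)[OF N])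
  let ?L = "msub N (star v)"
  note starV = star_subset[OF v]
  note L = msub_subgroup[OF N starV]
  have LP: "?L \<subseteq> carrier P" using subgroup.subset[OF L] .
  define D where "D = carrier P - ?L"
  \<comment> \<open>\<open>?L\<close> is rewritten as the coset through the identity, so that the
    invariance of cosets passes to \<open>?L\<close> and to its complement \<open>D\<close>.\<close>
  have L_eq: "{x \<in> carrier P. x \<otimes>\<^bsub>P\<^esub> inv\<^bsub>P\<^esub> \<one>\<^bsub>P\<^esub> \<in> ?L} = ?L" using LP by auto
  have "star_invariant v D"
    using star_invariant_coset[OF v N P.one_closed] starV unfolding L_eq D_def star_invariant_def
    by (auto simp: subset_iff)
  then obtain c where c: "cocycle v D c" using ex_cocycle[OF v] by blast
  have "star_invariant v (carrier P)"
    using starV by (auto simp: star_invariant_def subset_iff)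
  then obtain c' where c': "cocycle v (carrier P) c'" using ex_cocycle[OF v] by blast
  have incl_L: "incl v b \<in> ?L" if "b \<in> carrier (G v)" for b
    using subset_msub(2)[OF N starV] incl_in_sub[OF starV _ that] by (auto simp: star_def)
  let ?K = "{g \<in> N. \<forall>x \<in> carrier P. c g x \<in> M}" and ?K' = "{g \<in> N. \<forall>x \<in> carrier P. c' g x \<in> M}"
  have "fin_normal P ?K"
  proof (rule fin_normal_cocycle[OF c v N M(1)])
    show "x \<otimes>\<^bsub>P\<^esub> n \<in> D \<longleftrightarrow> x \<in> D" if "x \<in> carrier P" "n \<in> N" for x n
      using coset_right_invariant[OF v N P.one_closed that] that unfolding L_eq D_def by simp
  qed
  moreover have "fin_normal P ?K'"
    by (rule fin_normal_cocycle[OF c' v N M(1)]) simp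
  ultimately have "fin_normal P (?K \<inter> ?K')" by (rule P.fin_normal_Int)
  moreover have "\<exists>A C. B = A @ C \<and> val C \<otimes>\<^bsub>P\<^esub> g \<in> ?L"
    if g: "g \<in> carrier P"
      and K: "(val B \<otimes>\<^bsub>P\<^esub> g) \<otimes>\<^bsub>P\<^esub> inv\<^bsub>P\<^esub> (g \<otimes>\<^bsub>P\<^esub> incl v a) \<in> ?K \<inter> ?K'" for g
  proof (rule ccontr)
    assume no: "\<not> ?thesis"
    let ?b = "val B" and ?i = "incl v a"
    define n where "n = (?b \<otimes>\<^bsub>P\<^esub> g) \<otimes>\<^bsub>P\<^esub> inv\<^bsub>P\<^esub> (g \<otimes>\<^bsub>P\<^esub> ?i)"
    have b: "?b \<in> carrier P" and i: "?i \<in> carrier P" using B v a by simp_all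
    have n: "n \<in> ?K" "n \<in> ?K'" and nP: "n \<in> carrier P" using K b i g by (auto simp: n_def)
    have eq: "?b \<otimes>\<^bsub>P\<^esub> g = n \<otimes>\<^bsub>P\<^esub> (g \<otimes>\<^bsub>P\<^esub> ?i)"
      using b i g by (simp add: n_def P.m_assoc)
    obtain w where w: "w \<in> words V" "g = val w" using ex_word[OF g] by blast
    have split: "val C \<in> carrier P" if "w' = A @ (v, b) # C" "w' \<in> words V" for w' A b C
      using that by simp
    \<comment> \<open>Starting at \<open>?i\<close> instead of the identity multiplies every point
      on the right by \<open>?i\<close>. As \<open>?i\<close> lies in \<open>?L\<close>, this keeps
      points in or out of \<open>D\<close>.\<close>
    have shift: "d g ?i = d g \<one>\<^bsub>P\<^esub>"
      if d: "cocycle v D' d" and D': "\<And>x. x \<in> carrier P \<Longrightarrow> x \<otimes>\<^bsub>P\<^esub> ?i \<in> D' \<longleftrightarrow> x \<in> D'" for d D'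
      unfolding w(2) by (rule cocycle_cong[OF d d v w(1) i P.one_closed]) (use split D' w(1) in auto)
    have "c ?b g \<otimes>\<^bsub>G v\<^esub> c g \<one>\<^bsub>P\<^esub> = c (?b \<otimes>\<^bsub>P\<^esub> g) \<one>\<^bsub>P\<^esub>"
      using b g by (simp add: cocycleD(2)[OF c])
    also have "\<dots> = c n (g \<otimes>\<^bsub>P\<^esub> ?i) \<otimes>\<^bsub>G v\<^esub> (c g ?i \<otimes>\<^bsub>G v\<^esub> c ?i \<one>\<^bsub>P\<^esub>)"
      using nP g i by (simp add: eq cocycleD(2)[OF c])
    \<comment> \<open>The identity lies in \<open>?L\<close>, hence outside \<open>D\<close>, and
      the syllable \<open>a\<close> is not counted.\<close>
    also have "c ?i \<one>\<^bsub>P\<^esub> = \<one>\<^bsub>G v\<^esub>"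
      using v a subgroup.one_closed[OF L] by (simp add: cocycleD(3)[OF c] D_def)
    also have "c g ?i = c g \<one>\<^bsub>P\<^esub>"
      by (rule shift[OF c]) (use P.subgroup_mult_right_iff[OF L incl_L[OF a(1)]] i in \<open>auto simp: D_def\<close>)
    finally have "c ?b g = c n (g \<otimes>\<^bsub>P\<^esub> ?i)"
      using cocycleD(1)[OF c] b g i nP by simp
    then have "c ?b g \<in> M" using n g i by simp
    \<comment> \<open>If no suffix carries \<open>g\<close> into \<open>?L\<close>, every
      \<open>v\<close>-syllable of \<open>B\<close> is read in \<open>D\<close>, and both cocycles
      count all of them.\<close>
    moreover have "c' ?b g = c ?b g"
    proof (rule cocycle_cong[OF c' c v B g g])
      fix A b C assume BC: "B = A @ (v, b) # C"
      then have "B = (A @ [(v, b)]) @ C" "C \<in> words V" using B by auto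
      then show "val C \<otimes>\<^bsub>P\<^esub> g \<in> carrier P \<longleftrightarrow> val C \<otimes>\<^bsub>P\<^esub> g \<in> D"
        using no g by (auto simp: D_def)
    qed
    ultimately have m1: "c' ?b g \<in> M" by simp
    have m2: "c' n (g \<otimes>\<^bsub>P\<^esub> ?i) \<in> M" using n g i by simp
    let ?k = "c' g \<one>\<^bsub>P\<^esub>"
    have k: "?k \<in> carrier (G v)" using cocycleD(1)[OF c'] g by simp
    have "c' ?b g \<otimes>\<^bsub>G v\<^esub> ?k = c' (?b \<otimes>\<^bsub>P\<^esub> g) \<one>\<^bsub>P\<^esub>"
      using b g by (simp add: cocycleD(2)[OF c'])
    also have "\<dots> = c' n (g \<otimes>\<^bsub>P\<^esub> ?i) \<otimes>\<^bsub>G v\<^esub> (c' g ?i \<otimes>\<^bsub>G v\<^esub> c' ?i \<one>\<^bsub>P\<^esub>)"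
      using nP g i by (simp add: eq cocycleD(2)[OF c'])
    also have "c' ?i \<one>\<^bsub>P\<^esub> = a" using v a by (simp add: cocycleD(3)[OF c'])
    also have "c' g ?i = ?k" by (rule shift[OF c']) (use i in auto)
    finally have "?k \<otimes>\<^bsub>G v\<^esub> a = inv\<^bsub>G v\<^esub> c' n (g \<otimes>\<^bsub>P\<^esub> ?i) \<otimes>\<^bsub>G v\<^esub> (c' ?b g \<otimes>\<^bsub>G v\<^esub> ?k)"
      using m1 m2 k a by (simp add: Gv.m_assoc[symmetric])
    then have "?k \<otimes>\<^bsub>G v\<^esub> a \<otimes>\<^bsub>G v\<^esub> inv\<^bsub>G v\<^esub> ?k = inv\<^bsub>G v\<^esub> c' n (g \<otimes>\<^bsub>P\<^esub> ?i) \<otimes>\<^bsub>G v\<^esub> c' ?b g"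
      using m1 m2 k a by (simp add: Gv.m_assoc)
    then have "?k \<otimes>\<^bsub>G v\<^esub> a \<otimes>\<^bsub>G v\<^esub> inv\<^bsub>G v\<^esub> ?k \<in> M" using m1 m2 by simp
    \<comment> \<open>A conjugate of \<open>a\<close> lies in \<open>M\<close>; undoing the
      conjugation contradicts the choice of \<open>M\<close>.\<close>
    then have "inv\<^bsub>G v\<^esub> ?k \<otimes>\<^bsub>G v\<^esub> (?k \<otimes>\<^bsub>G v\<^esub> a \<otimes>\<^bsub>G v\<^esub> inv\<^bsub>G v\<^esub> ?k) \<otimes>\<^bsub>G v\<^esub> ?k \<in> M"
      using k by (rule M.inv_op_closed1[rotated])
    then show False using M(2) k a by (simp add: Gv.m_assoc Gv.inv_mult_cancel)
  qed
  ultimately show ?thesis by blast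
qed

end

section \<open>Automorphisms that are inner in every finite quotient\<close>

context vertex_groups
begin

text \<open>The retraction deletes the syllables outside \<open>S\<close>; on words it is a filter,
  which also shows where it sends \<langle>T\<rangle>.\<close>

lemma ex_retraction:
  assumes S: "S \<subseteq> V"
  shows "\<exists>\<rho>. group_hom P P \<rho> \<and> (\<forall>x \<in> sub S. \<rho> x = x) \<and> (\<forall>T \<subseteq> V. \<rho> ` sub T \<subseteq> sub (S \<inter> T))"
proof -
  define h where "h v a = (if v \<in> S then incl v a else \<one>\<^bsub>P\<^esub>)" for v a
  have hom: "h v \<in> hom (G v) P" if "v \<in> V" for v
    using that by (auto simp: h_def hom_def incl_mult)
  have comm: "h u a \<otimes>\<^bsub>P\<^esub> h v b = h v b \<otimes>\<^bsub>P\<^esub> h u a"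
    if "{u, v} \<in> E" "a \<in> carrier (G u)" "b \<in> carrier (G v)" for u v a b
    using incl_commute[OF that] edge_in_V[OF that(1)] that by (auto simp: h_def)
  obtain \<rho> where \<rho>: "group_hom P P \<rho>"
    "\<And>v a. v \<in> V \<Longrightarrow> a \<in> carrier (G v) \<Longrightarrow> \<rho> (incl v a) = h v a"
    using graph_product_universal[OF P.is_group hom comm] by blast
  interpret \<rho>: group_hom P P \<rho> by (rule \<rho>(1))
  have \<rho>_val: "\<rho> (val w) = val (filter (\<lambda>p. fst p \<in> S) w)" if "w \<in> words V" for w
    using that
  proof (induction w rule: list.induct)
    case (Cons p w)
    obtain v a where p: "p = (v, a)" by (cases p)
    have "filter (\<lambda>p. fst p \<in> S) w \<in> words V" using Cons.prems p by (auto simp: words_def)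
    then show ?case using Cons p by (simp add: \<rho>(2) h_def)
  qed simp
  have "\<rho> x = x" if x: "x \<in> sub S" for x
  proof -
    obtain w where w: "w \<in> words S" "x = val w" using x by (auto simp: sub_def)
    have "filter (\<lambda>p. fst p \<in> S) w = w" using w(1) by (auto simp: words_def filter_id_conv)
    then show ?thesis using \<rho>_val[OF words_mono[OF S w(1)]] w by simp
  qed
  moreover have "\<rho> x \<in> sub (S \<inter> T)" if T: "T \<subseteq> V" and x: "x \<in> sub T" for x T
  proof -
    obtain w where w: "w \<in> words T" "x = val w" using x by (auto simp: sub_def)
    have "filter (\<lambda>p. fst p \<in> S) w \<in> words (S \<inter> T)" using w(1) by (auto simp: words_def)
    then show ?thesis using \<rho>_val[OF words_mono[OF T w(1)]] w by (simp add: sub_def)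
  qed
  ultimately show ?thesis using \<rho>(1) by blast
qed

definition conj_mod ::
    "(('v \<times> 'a) list set set \<Rightarrow> ('v \<times> 'a) list set set) \<Rightarrow> ('v \<times> 'a) list set set set \<Rightarrow>
      ('v \<times> 'a) list set set \<Rightarrow> bool" where
  "conj_mod \<phi> N g \<longleftrightarrow> (\<forall>x \<in> carrier P. (\<phi> x \<otimes>\<^bsub>P\<^esub> g) \<otimes>\<^bsub>P\<^esub> inv\<^bsub>P\<^esub> (g \<otimes>\<^bsub>P\<^esub> x) \<in> N)"

lemma conj_mod_mono: "conj_mod \<phi> M g \<Longrightarrow> M \<subseteq> N \<Longrightarrow> conj_mod \<phi> N g"
  by (auto simp: conj_mod_def)

text \<open>Conjugation in \<open>P Mod N\<close> depends only on the coset of the conjugating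
  element.\<close>

lemma conj_mod_coset:
  assumes N: "N \<lhd> P" and \<phi>: "\<phi> \<in> carrier P \<rightarrow> carrier P"
    and n: "n \<in> N" and g: "g \<in> carrier P" and c: "conj_mod \<phi> N (n \<otimes>\<^bsub>P\<^esub> g)"
  shows "conj_mod \<phi> N g"
  unfolding conj_mod_def
proof
  interpret N: normal N P by fact
  fix x assume x: "x \<in> carrier P"
  have nP: "n \<in> carrier P" and fx: "\<phi> x \<in> carrier P" using n \<phi> x by auto
  have "N #>\<^bsub>P\<^esub> n = N #>\<^bsub>P\<^esub> \<one>\<^bsub>P\<^esub>"
    using n nP by (simp add: P.r_coset_eq_iff[OF N.is_subgroup] del: P.coset_mult_one)
  then have eq: "N #>\<^bsub>P\<^esub> (n \<otimes>\<^bsub>P\<^esub> g) = N #>\<^bsub>P\<^esub> g"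
    using N.rcos_sum[OF nP g] N.rcos_sum[OF P.one_closed g] g by simp
  have "N #>\<^bsub>P\<^esub> (\<phi> x \<otimes>\<^bsub>P\<^esub> (n \<otimes>\<^bsub>P\<^esub> g)) = N #>\<^bsub>P\<^esub> ((n \<otimes>\<^bsub>P\<^esub> g) \<otimes>\<^bsub>P\<^esub> x)"
    using c x g nP fx unfolding conj_mod_def by (simp add: P.r_coset_eq_iff[OF N.is_subgroup])
  then have "N #>\<^bsub>P\<^esub> (\<phi> x \<otimes>\<^bsub>P\<^esub> g) = N #>\<^bsub>P\<^esub> (g \<otimes>\<^bsub>P\<^esub> x)"
    using eq N.rcos_sum[OF fx, of "n \<otimes>\<^bsub>P\<^esub> g"] N.rcos_sum[OF fx g]
      N.rcos_sum[of "n \<otimes>\<^bsub>P\<^esub> g" x] N.rcos_sum[OF g x] g nP x by simp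
  then show "(\<phi> x \<otimes>\<^bsub>P\<^esub> g) \<otimes>\<^bsub>P\<^esub> inv\<^bsub>P\<^esub> (g \<otimes>\<^bsub>P\<^esub> x) \<in> N"
    using x g fx by (simp add: P.r_coset_eq_iff[OF N.is_subgroup])
qed

text \<open>If \<open>g\<close> in \<langle>S\<rangle> conjugates \<open>incl u a\<close> to
  \<open>val B\<close> modulo a fine enough subgroup, some suffix \<open>C\<close> of
  \<open>B\<close> brings \<open>g\<close> into \<langle>star u\<rangle> modulo \<open>?N1\<close>.
  Applying the retraction onto \<langle>S\<rangle> moves both \<open>C\<close> and the element of
  \<langle>star u\<rangle> into \<langle>S\<rangle> without changing \<open>g\<close>.\<close>

lemma conjugator_in_star:
  assumes rf: "\<And>v. v \<in> V \<Longrightarrow> residually_finite (G v)"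
    and nontriv: "\<And>v. v \<in> V \<Longrightarrow> carrier (G v) \<noteq> {\<one>\<^bsub>G v\<^esub>}"
    and \<phi>: "\<phi> \<in> carrier P \<rightarrow> carrier P" and S: "S \<subseteq> V" and t: "t \<in> carrier P" and u: "u \<in> V"
    and approx: "\<And>N. fin_normal P N \<Longrightarrow> \<exists>g \<in> sub S. conj_mod \<phi> N (t \<otimes>\<^bsub>P\<^esub> g)"
  shows "\<exists>t' \<in> carrier P. \<forall>N. fin_normal P N \<longrightarrow> (\<exists>g \<in> sub (S \<inter> star u). conj_mod \<phi> N (t' \<otimes>\<^bsub>P\<^esub> g))"
proof -
  interpret Gu: group "G u" using grp u .
  obtain a where a: "a \<in> carrier (G u)" "a \<noteq> \<one>\<^bsub>G u\<^esub>" using nontriv[OF u] Gu.one_closed by blast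
  let ?i = "incl u a"
  have i: "?i \<in> carrier P" using u a by simp
  have fi: "\<phi> ?i \<in> carrier P" using \<phi> i by blast
  have subP: "x \<in> carrier P" if "x \<in> sub T" "T \<subseteq> V" for x T
    using subgroup.mem_carrier[OF sub_subgroup[OF that(2)] that(1)] .
  \<comment> \<open>Absorbing \<open>t\<close> into the word \<open>B\<close> makes \<open>g\<close>
    itself, rather than \<open>t\<close> times \<open>g\<close>, the conjugating element.\<close>
  have "inv\<^bsub>P\<^esub> t \<otimes>\<^bsub>P\<^esub> \<phi> ?i \<otimes>\<^bsub>P\<^esub> t \<in> carrier P" using t fi by simp
  from ex_word[OF this] obtain B where B: "B \<in> words V"
    "inv\<^bsub>P\<^esub> t \<otimes>\<^bsub>P\<^esub> \<phi> ?i \<otimes>\<^bsub>P\<^esub> t = val B" by blast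
  obtain \<rho> where \<rho>: "group_hom P P \<rho>" "\<And>x. x \<in> sub S \<Longrightarrow> \<rho> x = x"
    "\<And>T x. T \<subseteq> V \<Longrightarrow> x \<in> sub T \<Longrightarrow> \<rho> x \<in> sub (S \<inter> T)"
    using ex_retraction[OF S] by (metis image_subset_iff)
  interpret \<rho>: group_hom P P \<rho> by (rule \<rho>(1))
  \<comment> \<open>These candidates for \<open>t'\<close> depend on \<open>B\<close> but not on
    \<open>N\<close>, and are finitely many.\<close>
  define T where "T = (\<lambda>C. t \<otimes>\<^bsub>P\<^esub> inv\<^bsub>P\<^esub> \<rho> (val C)) ` {C. \<exists>A. B = A @ C}"
  have "{C. \<exists>A. B = A @ C} \<subseteq> {m. \<exists>A C. B = A @ m @ C}"
  proof (rule Collect_mono, rule impI)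
    fix C assume "\<exists>A. B = A @ C"
    then obtain A where "B = A @ C @ []" by auto
    then show "\<exists>A' C'. B = A' @ C @ C'" by blast
  qed
  then have "finite T"
    unfolding T_def by (intro finite_imageI) (rule finite_subset[OF _ finite_infixes])
  have TP: "t' \<in> carrier P" if "t' \<in> T" for t' using that t B by (auto simp: T_def)
  have step: "\<exists>t' \<in> T. \<exists>g \<in> sub (S \<inter> star u). conj_mod \<phi> N (t' \<otimes>\<^bsub>P\<^esub> g)" if N: "fin_normal P N" for N
  proof -
    interpret N: normal N P by (rule fin_normalD(1)[OF N])
    \<comment> \<open>The second factor ensures that the error term \<open>n\<close> stays in
      \<open>N\<close> after retraction.\<close>
    let ?N1 = "N \<inter> {x \<in> carrier P. \<rho> x \<in> N}"
    have N1: "fin_normal P ?N1" by (rule P.fin_normal_Int[OF N P.fin_normal_vimage[OF \<rho>(1) N]])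
    obtain N' where N': "fin_normal P N'" and suffix:
      "\<And>g. g \<in> carrier P \<Longrightarrow> (val B \<otimes>\<^bsub>P\<^esub> g) \<otimes>\<^bsub>P\<^esub> inv\<^bsub>P\<^esub> (g \<otimes>\<^bsub>P\<^esub> ?i) \<in> N' \<Longrightarrow>
        \<exists>A C. B = A @ C \<and> val C \<otimes>\<^bsub>P\<^esub> g \<in> msub ?N1 (star u)"
      using conjugator_suffix[OF u rf[OF u] a B(1) N1] by blast
    interpret N': normal N' P by (rule fin_normalD(1)[OF N'])
    obtain g where g: "g \<in> sub S" "conj_mod \<phi> (N \<inter> N') (t \<otimes>\<^bsub>P\<^esub> g)"
      using approx[OF P.fin_normal_Int[OF N N']] by blast
    have gP: "g \<in> carrier P" using subP g(1) S .
    have "(\<phi> ?i \<otimes>\<^bsub>P\<^esub> (t \<otimes>\<^bsub>P\<^esub> g)) \<otimes>\<^bsub>P\<^esub> inv\<^bsub>P\<^esub> ((t \<otimes>\<^bsub>P\<^esub> g) \<otimes>\<^bsub>P\<^esub> ?i) \<in> N'"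
      using g(2) i by (auto simp: conj_mod_def)
    then have "inv\<^bsub>P\<^esub> t \<otimes>\<^bsub>P\<^esub> ((\<phi> ?i \<otimes>\<^bsub>P\<^esub> (t \<otimes>\<^bsub>P\<^esub> g)) \<otimes>\<^bsub>P\<^esub> inv\<^bsub>P\<^esub> ((t \<otimes>\<^bsub>P\<^esub> g) \<otimes>\<^bsub>P\<^esub> ?i)) \<otimes>\<^bsub>P\<^esub> t \<in> N'"
      using t by (intro N'.inv_op_closed1)
    also have "inv\<^bsub>P\<^esub> t \<otimes>\<^bsub>P\<^esub> ((\<phi> ?i \<otimes>\<^bsub>P\<^esub> (t \<otimes>\<^bsub>P\<^esub> g)) \<otimes>\<^bsub>P\<^esub> inv\<^bsub>P\<^esub> ((t \<otimes>\<^bsub>P\<^esub> g) \<otimes>\<^bsub>P\<^esub> ?i)) \<otimes>\<^bsub>P\<^esub> t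
        = (val B \<otimes>\<^bsub>P\<^esub> g) \<otimes>\<^bsub>P\<^esub> inv\<^bsub>P\<^esub> (g \<otimes>\<^bsub>P\<^esub> ?i)"
      using t gP i fi by (simp add: B(2)[symmetric] P.m_assoc P.inv_mult_group)
    finally obtain A C where C: "B = A @ C" "val C \<otimes>\<^bsub>P\<^esub> g \<in> msub ?N1 (star u)"
      using suffix[OF gP] by blast
    obtain n h where n: "n \<in> N" "\<rho> n \<in> N" "n \<in> carrier P" and h: "h \<in> sub (star u)"
      and eq: "val C \<otimes>\<^bsub>P\<^esub> g = n \<otimes>\<^bsub>P\<^esub> h"
      using C(2) unfolding msub_iff by blast
    have CP: "val C \<in> carrier P" using B C by simp
    have hP: "h \<in> carrier P" using subP[OF h star_subset[OF u]] .
    let ?r = "\<rho> (val C)" and ?t' = "t \<otimes>\<^bsub>P\<^esub> inv\<^bsub>P\<^esub> \<rho> (val C)"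
    have r: "?r \<in> carrier P" and t': "?t' \<in> carrier P" using CP t by simp_all
    have "?r \<otimes>\<^bsub>P\<^esub> g = \<rho> n \<otimes>\<^bsub>P\<^esub> \<rho> h"
      \<comment> \<open>Here \<rho> fixes \<open>g\<close>, so \<open>g\<close> is solved for as an
        element of \<langle>S\<rangle>; modulo \<open>N\<close> the error \<rho> \<open>n\<close>
        disappears.\<close>
      using arg_cong[OF eq, of \<rho>] CP gP n hP \<rho>(2)[OF g(1)] by simp
    then have "g = inv\<^bsub>P\<^esub> ?r \<otimes>\<^bsub>P\<^esub> (\<rho> n \<otimes>\<^bsub>P\<^esub> \<rho> h)"
      using r gP by (metis P.inv_mult_cancel(1))
    then have "t \<otimes>\<^bsub>P\<^esub> g = (?t' \<otimes>\<^bsub>P\<^esub> \<rho> n \<otimes>\<^bsub>P\<^esub> inv\<^bsub>P\<^esub> ?t') \<otimes>\<^bsub>P\<^esub> (?t' \<otimes>\<^bsub>P\<^esub> \<rho> h)"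
      using t r n hP by (simp add: P.m_assoc P.inv_mult_cancel P.inv_mult_group)
    moreover have "?t' \<otimes>\<^bsub>P\<^esub> \<rho> n \<otimes>\<^bsub>P\<^esub> inv\<^bsub>P\<^esub> ?t' \<in> N" using N.inv_op_closed2[OF t' n(2)] .
    moreover have "conj_mod \<phi> N (t \<otimes>\<^bsub>P\<^esub> g)" using g(2) by (rule conj_mod_mono) simp
    ultimately have "conj_mod \<phi> N (?t' \<otimes>\<^bsub>P\<^esub> \<rho> h)"
      using conj_mod_coset[OF fin_normalD(1)[OF N] \<phi>] t' hP by (metis P.m_closed \<rho>.hom_closed)
    moreover have "\<rho> h \<in> sub (S \<inter> star u)" using \<rho>(3)[OF star_subset[OF u] h] .
    moreover have "?t' \<in> T" using C(1) by (auto simp: T_def)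
    ultimately show ?thesis by blast
  qed
  \<comment> \<open>Pigeonhole: if each candidate failed at some level, \<open>step\<close> at the
    intersection of these finitely many levels would contradict one of the failures.\<close>
  have "\<exists>t' \<in> T. \<forall>N. fin_normal P N \<longrightarrow> (\<exists>g \<in> sub (S \<inter> star u). conj_mod \<phi> N (t' \<otimes>\<^bsub>P\<^esub> g))"
  proof (rule ccontr)
    assume "\<not> ?thesis"
    then have "\<forall>t'\<in>T. \<exists>N. fin_normal P N \<and> \<not> (\<exists>g \<in> sub (S \<inter> star u). conj_mod \<phi> N (t' \<otimes>\<^bsub>P\<^esub> g))"
      by blast
    then obtain f where f: "\<And>t'. t' \<in> T \<Longrightarrow> fin_normal P (f t')"
      "\<And>t' g. t' \<in> T \<Longrightarrow> g \<in> sub (S \<inter> star u) \<Longrightarrow> \<not> conj_mod \<phi> (f t') (t' \<otimes>\<^bsub>P\<^esub> g)"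
      by metis
    have "fin_normal P (carrier P \<inter> (\<Inter>t'\<in>T. f t'))"
      by (rule P.fin_normal_INT[OF \<open>finite T\<close> f(1)])
    from step[OF this] obtain t' g where tg: "t' \<in> T" "g \<in> sub (S \<inter> star u)"
      "conj_mod \<phi> (carrier P \<inter> (\<Inter>t'\<in>T. f t')) (t' \<otimes>\<^bsub>P\<^esub> g)" by blast
    have "conj_mod \<phi> (f t') (t' \<otimes>\<^bsub>P\<^esub> g)" by (rule conj_mod_mono[OF tg(3)]) (use tg(1) in blast)
    then show False using f(2)[OF tg(1,2)] by blast
  qed
  then show ?thesis using TP by blast
qed

text \<open>The translate \<open>t\<close> is adjusted along with \<open>S\<close> and does not
  depend on \<open>N\<close>. Once \<open>S\<close> is empty, one and the same \<open>t\<close>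
  therefore works modulo every \<open>N\<close>.\<close>

lemma locally_inner_imp_inner:
  assumes fin: "finite V" and no_central: "\<not> (\<exists>v. central_vertex V E v)"
    and rf: "\<And>v. v \<in> V \<Longrightarrow> residually_finite (G v)"
    and nontriv: "\<And>v. v \<in> V \<Longrightarrow> carrier (G v) \<noteq> {\<one>\<^bsub>G v\<^esub>}"
    and \<phi>: "\<phi> \<in> carrier P \<rightarrow> carrier P"
    and approx: "\<And>N. fin_normal P N \<Longrightarrow> \<exists>g \<in> carrier P. conj_mod \<phi> N g"
  shows "\<exists>t \<in> carrier P. \<forall>x \<in> carrier P. \<phi> x = t \<otimes>\<^bsub>P\<^esub> x \<otimes>\<^bsub>P\<^esub> inv\<^bsub>P\<^esub> t"
proof -
  define Q where "Q S \<longleftrightarrow> S \<subseteq> V \<and> (\<exists>t \<in> carrier P. \<forall>N. fin_normal P N \<longrightarrow>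
    (\<exists>g \<in> sub S. conj_mod \<phi> N (t \<otimes>\<^bsub>P\<^esub> g)))" for S
  \<comment> \<open>The descent starts from \<open>S = V\<close> with \<open>t\<close> the
    identity.\<close>
  have "\<exists>g \<in> sub V. conj_mod \<phi> N (\<one>\<^bsub>P\<^esub> \<otimes>\<^bsub>P\<^esub> g)" if "fin_normal P N" for N
    using approx[OF that] by (auto simp: sub_V)
  then have "Q V" unfolding Q_def by blast
  then obtain S where S: "Q S" and least: "\<And>S'. Q S' \<Longrightarrow> card S \<le> card S'"
    using ex_has_least_nat[of Q V card] by blast
  obtain t where SV: "S \<subseteq> V" and t: "t \<in> carrier P"
    and tN: "\<And>N. fin_normal P N \<Longrightarrow> \<exists>g \<in> sub S. conj_mod \<phi> N (t \<otimes>\<^bsub>P\<^esub> g)"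
    using S unfolding Q_def by blast
  have "S \<subseteq> star u" if u: "u \<in> V" for u
  proof -
    have "Q (S \<inter> star u)"
      unfolding Q_def using conjugator_in_star[OF rf nontriv \<phi> SV t u tN] SV by blast
    then have "card S \<le> card (S \<inter> star u)" by (rule least)
    then have "S \<inter> star u = S"
      using finite_subset[OF SV fin] by (intro card_seteq) auto
    then show ?thesis by blast
  qed
  \<comment> \<open>A vertex of \<open>S\<close> lies in the star of every vertex, so it is adjacent
    to all the others.\<close>
  then have "central_vertex V E v" if "v \<in> S" for v
    using that SV by (auto simp: central_vertex_def star_def)
  then have "S = {}" using no_central by blast
  have sub_empty: "sub {} = {\<one>\<^bsub>P\<^esub>}"
    by (auto simp: sub_def words_def)
  have "conj_mod \<phi> N t" if "fin_normal P N" for N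
    using tN[OF that] t by (simp add: \<open>S = {}\<close> sub_empty)
  then have one: "(\<phi> x \<otimes>\<^bsub>P\<^esub> t) \<otimes>\<^bsub>P\<^esub> inv\<^bsub>P\<^esub> (t \<otimes>\<^bsub>P\<^esub> x) = \<one>\<^bsub>P\<^esub>" if "x \<in> carrier P" for x
    using that \<phi> t by (intro residually_finite_P[OF rf]) (auto simp: conj_mod_def)
  have "\<phi> x = t \<otimes>\<^bsub>P\<^esub> x \<otimes>\<^bsub>P\<^esub> inv\<^bsub>P\<^esub> t" if x: "x \<in> carrier P" for x
  proof -
    have fx: "\<phi> x \<in> carrier P" using \<phi> x by blast
    have "\<phi> x \<otimes>\<^bsub>P\<^esub> t = \<one>\<^bsub>P\<^esub> \<otimes>\<^bsub>P\<^esub> (t \<otimes>\<^bsub>P\<^esub> x)"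
      using P.inv_solve_right[of "\<one>\<^bsub>P\<^esub>" "\<phi> x \<otimes>\<^bsub>P\<^esub> t" "t \<otimes>\<^bsub>P\<^esub> x"] one[OF x] fx t x by simp
    then show ?thesis
      using P.inv_solve_right[of "\<phi> x" "t \<otimes>\<^bsub>P\<^esub> x" t] fx t x by simp
  qed
  then show ?thesis using t by blast
qed

section \<open>Finite generation and inner automorphism separability of the graph product\<close>

lemma finitely_generated_P:
  assumes fin: "finite V" and fg: "\<And>v. v \<in> V \<Longrightarrow> finitely_generated_group (G v)"
  shows "finitely_generated_group P"
proof -
  have "\<forall>v\<in>V. \<exists>Y. finite Y \<and> Y \<subseteq> carrier (G v) \<and> generate (G v) Y = carrier (G v)"
    using fg by (simp add: finitely_generated_group_def)
  then obtain Y where Y: "\<And>v. v \<in> V \<Longrightarrow> finite (Y v)" "\<And>v. v \<in> V \<Longrightarrow> Y v \<subseteq> carrier (G v)"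
    "\<And>v. v \<in> V \<Longrightarrow> generate (G v) (Y v) = carrier (G v)"
    by metis
  define Z where "Z = (\<Union>v\<in>V. incl v ` Y v)"
  have ZP: "Z \<subseteq> carrier P" using Y(2) by (auto simp: Z_def subset_iff)
  interpret Z: subgroup "generate P Z" P by (rule P.generate_is_subgroup[OF ZP])
  have incl_gen: "incl v a \<in> generate P Z" if v: "v \<in> V" and a: "a \<in> carrier (G v)" for v a
  proof -
    have "a \<in> generate (G v) (Y v)" using Y(3)[OF v] a by simp
    then show ?thesis
    proof (induction rule: generate.induct)
      case one
      then show ?case using v by (simp add: incl_one)
    next
      case (incl h)
      then show ?case using v by (intro generate.incl) (auto simp: Z_def)
    next
      case (inv h)
      then have "incl v h \<in> Z" using v by (auto simp: Z_def)
      then show ?case using inv Y(2)[OF v] v generate.inv[of "incl v h" Z P] by (auto simp: incl_inv)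
    next
      case (eng h1 h2)
      then show ?case using Y(3)[OF v] v by (simp add: incl_mult)
    qed
  qed
  have "val w \<in> generate P Z" if "w \<in> words V" for w
    using that
  proof (induction w rule: list.induct)
    case (Cons p w)
    then show ?case by (cases p) (auto intro: incl_gen)
  qed simp
  then have "carrier P \<subseteq> generate P Z" using ex_word by blast
  then have "generate P Z = carrier P" using Z.subset by blast
  then show ?thesis
    unfolding finitely_generated_group_def using ZP fin Y(1) by (intro exI[of _ Z]) (auto simp: Z_def)
qed

text \<open>By contraposition: if \<phi> is inner on all characteristic quotients of finite index,
  it is so modulo every \<open>N\<close> of finite index, because finite generation provides a
  characteristic \<open>K\<close> inside \<open>N\<close>. Then \<phi> is inner.\<close>

lemma inner_automorphism_separable_P:
  assumes fin: "finite V" and no_central: "\<not> (\<exists>v. central_vertex V E v)"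
    and fg: "\<And>v. v \<in> V \<Longrightarrow> finitely_generated_group (G v)"
    and rf: "\<And>v. v \<in> V \<Longrightarrow> residually_finite (G v)"
    and nontriv: "\<And>v. v \<in> V \<Longrightarrow> carrier (G v) \<noteq> {\<one>\<^bsub>G v\<^esub>}"
  shows "inner_automorphism_separable P"
  unfolding inner_automorphism_separable_def
proof (rule ballI, rule ccontr)
  fix \<phi> assume \<phi>_mem: "\<phi> \<in> auto P - inner_auto P"
    and neg: "\<not> (\<exists>K. characteristic_subgroup K P \<and> finite_index P K \<and>
      induced_auto P K \<phi> \<notin> inner_auto (P Mod K))"
  have \<phi>: "\<phi> \<in> auto P" using \<phi>_mem by blast
  interpret \<phi>: group_hom P P \<phi> by (rule P.auto_hom[OF \<phi>])
  have approx: "\<exists>g \<in> carrier P. conj_mod \<phi> N g" if N: "fin_normal P N" for N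
  proof -
    obtain K where K: "characteristic_subgroup K P" "finite_index P K" "K \<subseteq> N"
      using P.ex_characteristic_subgroup_below[OF finitely_generated_P[OF fin fg] N] by blast
    interpret K: normal K P by (rule P.characteristic_subgroup_normal[OF K(1)])
    interpret q: group_hom P "P Mod K" "\<lambda>a. K #>\<^bsub>P\<^esub> a"
      by (intro group_hom.intro group_hom_axioms.intro K.factorgroup_is_group P.is_group K.r_coset_hom_Mod)
    have "induced_auto P K \<phi> \<in> inner_auto (P Mod K)" using neg K by blast
    then obtain g where g: "g \<in> carrier P" "induced_auto P K \<phi> = (\<lambda>C\<in>carrier (P Mod K).
        (K #>\<^bsub>P\<^esub> g) \<otimes>\<^bsub>P Mod K\<^esub> C \<otimes>\<^bsub>P Mod K\<^esub> inv\<^bsub>P Mod K\<^esub> (K #>\<^bsub>P\<^esub> g))"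
      by (auto simp: inner_auto_def carrier_FactGroup)
    have "conj_mod \<phi> K g"
      unfolding conj_mod_def
    proof
      fix x assume x: "x \<in> carrier P"
      have "K #>\<^bsub>P\<^esub> x \<in> carrier (P Mod K)" using x by (auto simp: carrier_FactGroup)
      then have "K #>\<^bsub>P\<^esub> \<phi> x
          = (K #>\<^bsub>P\<^esub> g) \<otimes>\<^bsub>P Mod K\<^esub> (K #>\<^bsub>P\<^esub> x) \<otimes>\<^bsub>P Mod K\<^esub> inv\<^bsub>P Mod K\<^esub> (K #>\<^bsub>P\<^esub> g)"
        using P.induced_auto_r_coset[OF K(1) \<phi> x] g(2) by simp
      also have "\<dots> = K #>\<^bsub>P\<^esub> (g \<otimes>\<^bsub>P\<^esub> x \<otimes>\<^bsub>P\<^esub> inv\<^bsub>P\<^esub> g)"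
        using g(1) x by (simp only: q.hom_mult q.hom_inv P.m_closed P.inv_closed)
      finally have "\<phi> x \<otimes>\<^bsub>P\<^esub> inv\<^bsub>P\<^esub> (g \<otimes>\<^bsub>P\<^esub> x \<otimes>\<^bsub>P\<^esub> inv\<^bsub>P\<^esub> g) \<in> K"
        using g(1) x by (subst (asm) P.r_coset_eq_iff[OF K.is_subgroup]) auto
      then show "(\<phi> x \<otimes>\<^bsub>P\<^esub> g) \<otimes>\<^bsub>P\<^esub> inv\<^bsub>P\<^esub> (g \<otimes>\<^bsub>P\<^esub> x) \<in> K"
        using g(1) x by (simp add: P.inv_mult_group P.m_assoc)
    qed
    then show ?thesis using g(1) K(3) conj_mod_mono by blast
  qed
  have "\<phi> \<in> carrier P \<rightarrow> carrier P" by simp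
  from locally_inner_imp_inner[OF fin no_central rf nontriv this approx]
  obtain t where t: "t \<in> carrier P" "\<And>x. x \<in> carrier P \<Longrightarrow> \<phi> x = t \<otimes>\<^bsub>P\<^esub> x \<otimes>\<^bsub>P\<^esub> inv\<^bsub>P\<^esub> t"
    by blast
  have "\<phi> = (\<lambda>x\<in>carrier P. t \<otimes>\<^bsub>P\<^esub> x \<otimes>\<^bsub>P\<^esub> inv\<^bsub>P\<^esub> t)"
  proof (rule extensionalityI)
    show "\<phi> \<in> extensional (carrier P)" using \<phi> by (simp add: auto_def Bij_def)
  qed (use t in auto)
  then have "\<phi> \<in> inner_auto P" using t(1) by (auto simp: inner_auto_def)
  then show False using \<phi>_mem by blast
qed

end

theorem theorem1p3:
  fixes V :: "'v set" and E :: "'v set set"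
    and G :: "'v \<Rightarrow> ('a, 'm) monoid_scheme"
  assumes "finite V" and "simplicial_graph V E"
    and "\<not> (\<exists>v. central_vertex V E v)"
    and "\<And>v. v \<in> V \<Longrightarrow> group (G v)"
    and "\<And>v. v \<in> V \<Longrightarrow> carrier (G v) \<noteq> {\<one>\<^bsub>G v\<^esub>}"
    and "\<And>v. v \<in> V \<Longrightarrow> finitely_generated_group (G v)"
    and "\<And>v. v \<in> V \<Longrightarrow> residually_finite (G v)"
  shows "inner_automorphism_separable (graph_product V E G) \<and>
         residually_finite (Out (graph_product V E G))"
proof -
  interpret vertex_groups V E G
    by (rule vertex_groups.intro) (rule assms(2), rule assms(4))
  have "inner_automorphism_separable P"
    by (rule inner_automorphism_separable_P[OF assms(1,3,6,7,5)])
  then show ?thesis using P.Out_residually_finite by blast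
qed

end
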